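(* Let $(A,\theta)$ be a commutative algebra with an involution over a commutative ring $k$ with $2\in k^\times$, let $\mathbf{A}$ be its contraction algebra, and let $f\in A$. If $\theta(f)=f$ (resp. $\theta(f)=-f$), then $\theta$ extends to an involution of the localization $A_f$. Moreover, the contraction algebra of $A_f$ is isomorphic to the localization of $\mathbf{A}$ by $f$ (resp. by $\sqrt{t}f$) if $\theta(f)=f$ (resp. $\theta(f)=-f$).
   Context: An involution of a commutative $k$-algebra $A$ is a $k$-algebra automorphism $\theta$ with $\theta\circ\theta=\mathrm{id}_A$. Put $A^{\theta}=\{a\in A:\theta(a)=a\}$ and $A^{-\theta}=\{a\in A:\theta(a)=-a\}$. The contraction algebra $\mathbf{A}$ of $(A,\theta)$ is the $k[t]$-subalgebra of the Laurent polynomial ring $A[\sqrt{t}^{\pm1}]$ (variable $\sqrt t$, $t=(\sqrt t)^2$) generated by $A^\theta$ and $\frac{1}{\sqrt t}A^{-\theta}$. Note $f\in\mathbf{A}$ if $\theta(f)=f$, and $\sqrt t f=t\cdot\frac{1}{\sqrt t}f\in\mathbf{A}$ if $\theta(f)=-f$. *)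

theory Defs
  imports "HOL-Algebra.Module" "HOL-Algebra.UnivPoly" "HOL-Algebra.Subrings"
begin

section \<open>Algebras with involution\<close>

definition algebra_iso ::
  "('k, 'r) ring_scheme \<Rightarrow> ('k, 'a, 'm) module_scheme \<Rightarrow> ('k, 'b, 'n) module_scheme \<Rightarrow> ('a \<Rightarrow> 'b) set"
  where "algebra_iso K A B =
    {h \<in> ring_iso A B. \<forall>c\<in>carrier K. \<forall>a\<in>carrier A. h (c \<odot>\<^bsub>A\<^esub> a) = c \<odot>\<^bsub>B\<^esub> h a}"

definition algebra_isomorphic ::
  "('k, 'r) ring_scheme \<Rightarrow> ('k, 'a, 'm) module_scheme \<Rightarrow> ('k, 'b, 'n) module_scheme \<Rightarrow> bool"
  where "algebra_isomorphic K A B \<longleftrightarrow> algebra_iso K A B \<noteq> {}"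

locale involutive_algebra = algebra K A
  for K :: "('k, 'r) ring_scheme" and A :: "('k, 'a, 'm) module_scheme" +
  fixes \<theta> :: "'a \<Rightarrow> 'a"
  assumes involution_automorphism: "\<theta> \<in> algebra_iso K A A"
    and involution_involutive: "\<And>a. a \<in> carrier A \<Longrightarrow> \<theta> (\<theta> a) = a"

definition fixed_part :: "('k, 'a, 'm) module_scheme \<Rightarrow> ('a \<Rightarrow> 'a) \<Rightarrow> 'a set"
  where "fixed_part A \<theta> = {a \<in> carrier A. \<theta> a = a}"

definition antifixed_part :: "('k, 'a, 'm) module_scheme \<Rightarrow> ('a \<Rightarrow> 'a) \<Rightarrow> 'a set"
  where "antifixed_part A \<theta> = {a \<in> carrier A. \<theta> a = \<ominus>\<^bsub>A\<^esub> a}"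


section \<open>Localization\<close>

definition fraction_rel ::
  "('k, 'a, 'm) module_scheme \<Rightarrow> 'a set \<Rightarrow> (('a \<times> 'a) \<times> ('a \<times> 'a)) set"
  where "fraction_rel A S =
    {((a, s), (b, u)). a \<in> carrier A \<and> s \<in> S \<and> b \<in> carrier A \<and> u \<in> S \<and>
      (\<exists>v\<in>S. v \<otimes>\<^bsub>A\<^esub> (u \<otimes>\<^bsub>A\<^esub> a \<ominus>\<^bsub>A\<^esub> s \<otimes>\<^bsub>A\<^esub> b) = \<zero>\<^bsub>A\<^esub>)}"

text \<open>The fraction \<open>a / s\<close>, as the class of the pair \<open>(a, s)\<close>.\<close>
definition fraction :: "('k, 'a, 'm) module_scheme \<Rightarrow> 'a set \<Rightarrow> 'a \<Rightarrow> 'a \<Rightarrow> ('a \<times> 'a) set"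
  where "fraction A S a s = fraction_rel A S `` {(a, s)}"

text \<open>
  For a multiplicatively closed set \<open>S\<close>, the value of each operation does not depend on the
  chosen representatives; the unions below are then over equal sets
  (compare \<open>UN_equiv_class\<close> and \<open>UN_equiv_class2\<close>).
\<close>
definition localization ::
  "('k, 'a, 'm) module_scheme \<Rightarrow> 'a set \<Rightarrow> ('k, ('a \<times> 'a) set) module"
  where "localization A S = \<lparr>
    carrier = (carrier A \<times> S) // fraction_rel A S,
    mult = (\<lambda>X Y. \<Union>(a, s)\<in>X. \<Union>(b, u)\<in>Y. fraction A S (a \<otimes>\<^bsub>A\<^esub> b) (s \<otimes>\<^bsub>A\<^esub> u)),
    one = fraction A S \<one>\<^bsub>A\<^esub> \<one>\<^bsub>A\<^esub>,
    zero = fraction A S \<zero>\<^bsub>A\<^esub> \<one>\<^bsub>A\<^esub>,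
    add = (\<lambda>X Y. \<Union>(a, s)\<in>X. \<Union>(b, u)\<in>Y.
      fraction A S (u \<otimes>\<^bsub>A\<^esub> a \<oplus>\<^bsub>A\<^esub> s \<otimes>\<^bsub>A\<^esub> b) (s \<otimes>\<^bsub>A\<^esub> u)),
    smult = (\<lambda>c X. \<Union>(a, s)\<in>X. fraction A S (c \<odot>\<^bsub>A\<^esub> a) s)\<rparr>"

definition powers :: "('k, 'a, 'm) module_scheme \<Rightarrow> 'a \<Rightarrow> 'a set"
  where "powers A f = range (\<lambda>n::nat. f [^]\<^bsub>A\<^esub> n)"

definition localization_at ::
  "('k, 'a, 'm) module_scheme \<Rightarrow> 'a \<Rightarrow> ('k, ('a \<times> 'a) set) module"
  where "localization_at A f = localization A (powers A f)"

definition to_localization_at :: "('k, 'a, 'm) module_scheme \<Rightarrow> 'a \<Rightarrow> 'a \<Rightarrow> ('a \<times> 'a) set"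
  where "to_localization_at A f a = fraction A (powers A f) a \<one>\<^bsub>A\<^esub>"


section \<open>Laurent polynomials in a square root of \<open>t\<close>\<close>

text \<open>
  The \<open>K[t]\<close>-algebra of Laurent polynomials over \<open>A\<close> in a variable \<open>\<surd>t\<close>: the function \<open>p\<close>
  stands for the sum of the \<open>p n \<cdot> (\<surd>t)\<^sup>n\<close>. As \<open>t = (\<surd>t)\<^sup>2\<close>, multiplying
  by \<open>c \<cdot> t\<^sup>i\<close> shifts exponents by \<open>2 * i\<close>.
\<close>
definition laurent ::
  "('k, 'r) ring_scheme \<Rightarrow> ('k, 'a, 'm) module_scheme \<Rightarrow> (nat \<Rightarrow> 'k, int \<Rightarrow> 'a) module"
  where "laurent K A = \<lparr>
    carrier = {p. range p \<subseteq> carrier A \<and> finite {n. p n \<noteq> \<zero>\<^bsub>A\<^esub>}},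
    mult = (\<lambda>p q n. \<Oplus>\<^bsub>A\<^esub>i\<in>{i. p i \<noteq> \<zero>\<^bsub>A\<^esub>}. p i \<otimes>\<^bsub>A\<^esub> q (n - i)),
    one = (\<lambda>n. if n = 0 then \<one>\<^bsub>A\<^esub> else \<zero>\<^bsub>A\<^esub>),
    zero = (\<lambda>n. \<zero>\<^bsub>A\<^esub>),
    add = (\<lambda>p q n. p n \<oplus>\<^bsub>A\<^esub> q n),
    smult = (\<lambda>c p n. \<Oplus>\<^bsub>A\<^esub>i\<in>{..deg K c}. coeff (UP K) c i \<odot>\<^bsub>A\<^esub> p (n - 2 * int i))\<rparr>"

definition laurent_monom :: "('k, 'a, 'm) module_scheme \<Rightarrow> 'a \<Rightarrow> int \<Rightarrow> int \<Rightarrow> 'a"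
  where "laurent_monom A a m = (\<lambda>n. if n = m then a else \<zero>\<^bsub>A\<^esub>)"


section \<open>The contraction algebra\<close>

definition algebra_generated ::
  "('k, 'r) ring_scheme \<Rightarrow> ('k, 'a, 'm) module_scheme \<Rightarrow> 'a set \<Rightarrow> 'a set"
  where "algebra_generated K A G =
    \<Inter>{B. subring B A \<and> (\<forall>c\<in>carrier K. \<forall>b\<in>B. c \<odot>\<^bsub>A\<^esub> b \<in> B) \<and> G \<subseteq> B}"

definition contraction_algebra ::
  "('k, 'r) ring_scheme \<Rightarrow> ('k, 'a, 'm) module_scheme \<Rightarrow> ('a \<Rightarrow> 'a) \<Rightarrow> (nat \<Rightarrow> 'k, int \<Rightarrow> 'a) module"
  where "contraction_algebra K A \<theta> = (laurent K A)\<lparr>carrier :=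
    algebra_generated (UP K) (laurent K A)
      ((\<lambda>a. laurent_monom A a 0) ` fixed_part A \<theta> \<union>
       (\<lambda>a. laurent_monom A a (- 1)) ` antifixed_part A \<theta>)\<rparr>"

end

theory Submission
  imports Defs
begin

text \<open>
  Let \<open>Q = A\<^sub>f\<close> and \<open>\<iota> : A \<rightarrow> Q\<close>. Since \<open>\<theta> f = \<plusminus> f\<close>, the homomorphism \<open>\<iota> \<circ> \<theta>\<close> inverts \<open>f\<close>, so it
  factors through an automorphism of \<open>Q\<close>. For the contraction algebras put \<open>F = f\<close> or \<open>F = \<surd>t f\<close>.
  Applying \<open>\<iota>\<close> to coefficients maps the contraction algebra of \<open>A\<close> into that of \<open>Q\<close>, and it makes
  \<open>F\<close> a unit, because \<open>1 / f\<close> is fixed (antifixed) in \<open>Q\<close>. Its kernel consists of the elements killed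
  by a power of \<open>F\<close>. The elements that become images after multiplication by a power of \<open>F\<close> form a
  \<open>K[t]\<close>-subalgebra, which contains the generators: an eigenvector \<open>x\<close> of the involution of \<open>Q\<close>
  satisfies \<open>x \<cdot> \<iota> s = \<iota> a\<close> for an even power \<open>s\<close> of \<open>f\<close> and some \<open>a\<close>; as \<open>s\<close> is fixed and \<open>2\<close> is
  invertible, \<open>a\<close> may be replaced by \<open>(a \<plusminus> \<theta> a) / 2\<close>. So the contraction algebra of \<open>Q\<close> has the
  universal property of the localization.
\<close>

section \<open>Localization of commutative rings\<close>

locale fraction_ring = cring R for R :: "('k, 'a, 'm) module_scheme" (structure) +
  fixes S :: "'a set"
  assumes S_subset: "S \<subseteq> carrier R"
    and S_one: "\<one> \<in> S"
    and S_mult: "\<And>s u. s \<in> S \<Longrightarrow> u \<in> S \<Longrightarrow> s \<otimes> u \<in> S"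
begin

lemma S_carrier [simp, intro]: "s \<in> S \<Longrightarrow> s \<in> carrier R"
  using S_subset by blast

text \<open>Distributivity trades the vanishing difference for an equality of two products. Later
  arguments about fractions can then simply rearrange factors with \<open>m_ac\<close>.\<close>

lemma fraction_rel_iff:
  "((a, s), (b, u)) \<in> fraction_rel R S \<longleftrightarrow> a \<in> carrier R \<and> s \<in> S \<and> b \<in> carrier R \<and> u \<in> S \<and>
    (\<exists>v\<in>S. v \<otimes> (u \<otimes> a) = v \<otimes> (s \<otimes> b))"
proof -
  have "v \<otimes> (u \<otimes> a \<ominus> s \<otimes> b) = \<zero> \<longleftrightarrow> v \<otimes> (u \<otimes> a) = v \<otimes> (s \<otimes> b)"
    if "a \<in> carrier R" "b \<in> carrier R" "s \<in> S" "u \<in> S" "v \<in> S" for v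
  proof -
    have "v \<otimes> (u \<otimes> a \<ominus> s \<otimes> b) = v \<otimes> (u \<otimes> a) \<ominus> v \<otimes> (s \<otimes> b)"
      using that by (simp add: minus_eq r_distr r_minus)
    then show ?thesis using that by (simp add: r_right_minus_eq)
  qed
  then show ?thesis by (auto simp: fraction_rel_def)
qed

lemma equiv_fraction_rel: "equiv (carrier R \<times> S) (fraction_rel R S)"
proof (rule equivI)
  show "fraction_rel R S \<subseteq> (carrier R \<times> S) \<times> (carrier R \<times> S)"
    by (auto simp: fraction_rel_def)
  show "refl_on (carrier R \<times> S) (fraction_rel R S)"
    using S_one by (auto simp: refl_on_def fraction_rel_iff)
  show "sym (fraction_rel R S)"
    by (rule symI) (metis fraction_rel_iff surj_pair)
  show "trans (fraction_rel R S)"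
  proof (rule transI)
    fix x y z assume xy: "(x, y) \<in> fraction_rel R S" and yz: "(y, z) \<in> fraction_rel R S"
    obtain a s b u c w where xyz: "x = (a, s)" "y = (b, u)" "z = (c, w)"
      by (metis surj_pair)
    from xy yz obtain v v' where C: "a \<in> carrier R" "s \<in> S" "b \<in> carrier R" "u \<in> S"
        "c \<in> carrier R" "w \<in> S" "v \<in> S" "v' \<in> S"
      and 1: "v \<otimes> (u \<otimes> a) = v \<otimes> (s \<otimes> b)" and 2: "v' \<otimes> (w \<otimes> b) = v' \<otimes> (u \<otimes> c)"
      unfolding xyz fraction_rel_iff by blast
    \<comment> \<open>The two witnesses are used in turn to eliminate the middle numerator
      \<open>b\<close>. This leaves the middle denominator \<open>u\<close> as an extra factor on
      both sides, so it joins the multiplier.\<close>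
    have "(v \<otimes> v' \<otimes> u) \<otimes> (w \<otimes> a) = (v \<otimes> (u \<otimes> a)) \<otimes> (v' \<otimes> w)"
      using C by (simp add: m_ac)
    also have "\<dots> = (v' \<otimes> (w \<otimes> b)) \<otimes> (v \<otimes> s)"
      unfolding 1 using C by (simp add: m_ac)
    also have "\<dots> = (v \<otimes> v' \<otimes> u) \<otimes> (s \<otimes> c)"
      unfolding 2 using C by (simp add: m_ac)
    finally have "\<exists>v\<in>S. v \<otimes> (w \<otimes> a) = v \<otimes> (s \<otimes> c)"
      using C S_mult by blast
    then show "(x, z) \<in> fraction_rel R S"
      unfolding xyz fraction_rel_iff using C by simp
  qed
qed

lemma fraction_eq_iff:
  assumes "a \<in> carrier R" "s \<in> S" "b \<in> carrier R" "u \<in> S"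
  shows "fraction R S a s = fraction R S b u \<longleftrightarrow> (\<exists>v\<in>S. v \<otimes> (u \<otimes> a) = v \<otimes> (s \<otimes> b))"
proof -
  have "fraction R S a s = fraction R S b u \<longleftrightarrow> ((a, s), (b, u)) \<in> fraction_rel R S"
    unfolding fraction_def using eq_equiv_class_iff[OF equiv_fraction_rel] assms by auto
  then show ?thesis using assms by (simp add: fraction_rel_iff)
qed

lemma fraction_eqI:
  assumes "a \<in> carrier R" "s \<in> S" "b \<in> carrier R" "u \<in> S" "u \<otimes> a = s \<otimes> b"
  shows "fraction R S a s = fraction R S b u"
  using assms S_one by (auto simp: fraction_eq_iff)

lemma mem_fraction_iff:
  assumes "a \<in> carrier R" "s \<in> S"
  shows "(b, u) \<in> fraction R S a s \<longleftrightarrow>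
    b \<in> carrier R \<and> u \<in> S \<and> fraction R S b u = fraction R S a s"
  using assms fraction_eq_iff[of a s b u]
  by (auto simp: fraction_def[of R S a s] fraction_rel_iff)

lemma carrier_localization:
  "carrier (localization R S) = {fraction R S a s | a s. a \<in> carrier R \<and> s \<in> S}"
  unfolding localization_def fraction_def quotient_def by auto

lemma fraction_closed [simp, intro]:
  "a \<in> carrier R \<Longrightarrow> s \<in> S \<Longrightarrow> fraction R S a s \<in> carrier (localization R S)"
  unfolding carrier_localization by blast

lemma fractionE:
  assumes "X \<in> carrier (localization R S)"
  obtains a s where "a \<in> carrier R" "s \<in> S" "X = fraction R S a s"
  using assms unfolding carrier_localization by blast

text \<open>The operations of \<open>localization\<close> are unions over all representatives. If
  each representative contributes the same set, the union collapses to it; \<open>(a, s)\<close>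
  itself shows that the index set is not empty.\<close>

lemma UN_fraction:
  assumes "a \<in> carrier R" "s \<in> S"
    and "\<And>b u. b \<in> carrier R \<Longrightarrow> u \<in> S \<Longrightarrow> fraction R S b u = fraction R S a s \<Longrightarrow> g b u = c"
  shows "(\<Union>(b, u)\<in>fraction R S a s. g b u) = c"
proof -
  have "(a, s) \<in> fraction R S a s" using assms by (simp add: mem_fraction_iff)
  moreover have "(case x of (b, u) \<Rightarrow> g b u) = c" if "x \<in> fraction R S a s" for x
    using that assms by (cases x) (simp add: mem_fraction_iff)
  ultimately show ?thesis by auto
qed

text \<open>The product of the two witnesses is a witness for the products. Together with
  \<open>fraction_add_cong\<close> this is the independence of representatives that
  \<open>UN_fraction\<close> asks for.\<close>

lemma fraction_mult_cong:
  assumes C: "a \<in> carrier R" "s \<in> S" "b \<in> carrier R" "u \<in> S"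
      "a' \<in> carrier R" "s' \<in> S" "b' \<in> carrier R" "u' \<in> S"
    and eq: "fraction R S a s = fraction R S b u" "fraction R S a' s' = fraction R S b' u'"
  shows "fraction R S (a \<otimes> a') (s \<otimes> s') = fraction R S (b \<otimes> b') (u \<otimes> u')"
proof -
  from eq obtain v v' where v: "v \<in> S" "v' \<in> S"
    and 1: "v \<otimes> (u \<otimes> a) = v \<otimes> (s \<otimes> b)" and 2: "v' \<otimes> (u' \<otimes> a') = v' \<otimes> (s' \<otimes> b')"
    using C by (auto simp: fraction_eq_iff)
  have "(v \<otimes> v') \<otimes> ((u \<otimes> u') \<otimes> (a \<otimes> a')) = (v \<otimes> (u \<otimes> a)) \<otimes> (v' \<otimes> (u' \<otimes> a'))"
    using C v by (simp add: m_ac)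
  also have "\<dots> = (v \<otimes> v') \<otimes> ((s \<otimes> s') \<otimes> (b \<otimes> b'))"
    unfolding 1 2 using C v by (simp add: m_ac)
  finally show ?thesis
    using C v S_mult by (auto simp: fraction_eq_iff intro!: bexI[of _ "v \<otimes> v'"])
qed

lemma fraction_add_cong:
  assumes C: "a \<in> carrier R" "s \<in> S" "b \<in> carrier R" "u \<in> S"
      "a' \<in> carrier R" "s' \<in> S" "b' \<in> carrier R" "u' \<in> S"
    and eq: "fraction R S a s = fraction R S b u" "fraction R S a' s' = fraction R S b' u'"
  shows "fraction R S (s' \<otimes> a \<oplus> s \<otimes> a') (s \<otimes> s') = fraction R S (u' \<otimes> b \<oplus> u \<otimes> b') (u \<otimes> u')"
proof -
  from eq obtain v v' where v: "v \<in> S" "v' \<in> S"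
    and 1: "v \<otimes> (u \<otimes> a) = v \<otimes> (s \<otimes> b)" and 2: "v' \<otimes> (u' \<otimes> a') = v' \<otimes> (s' \<otimes> b')"
    using C by (auto simp: fraction_eq_iff)
  have "(v \<otimes> v') \<otimes> ((u \<otimes> u') \<otimes> (s' \<otimes> a \<oplus> s \<otimes> a')) =
      (v \<otimes> (u \<otimes> a)) \<otimes> (v' \<otimes> u' \<otimes> s') \<oplus> (v' \<otimes> (u' \<otimes> a')) \<otimes> (v \<otimes> u \<otimes> s)"
    using C v by (simp add: m_ac r_distr)
  also have "\<dots> = (v \<otimes> v') \<otimes> ((s \<otimes> s') \<otimes> (u' \<otimes> b \<oplus> u \<otimes> b'))"
    unfolding 1 2 using C v by (simp add: m_ac r_distr)
  finally show ?thesis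
    using C v S_mult by (auto simp: fraction_eq_iff intro!: bexI[of _ "v \<otimes> v'"])
qed

lemma mult_fraction [simp]:
  assumes "a \<in> carrier R" "s \<in> S" "b \<in> carrier R" "u \<in> S"
  shows "fraction R S a s \<otimes>\<^bsub>localization R S\<^esub> fraction R S b u = fraction R S (a \<otimes> b) (s \<otimes> u)"
  unfolding localization_def monoid.select_convs ring.select_convs using assms
  \<comment> \<open>\<open>UN_fraction\<close> is applied once for each of the two nested unions;
    what remains is independence of both representatives.\<close>
  by - ((rule UN_fraction, assumption, assumption)+, rule fraction_mult_cong, assumption+)

lemma add_fraction [simp]:
  assumes "a \<in> carrier R" "s \<in> S" "b \<in> carrier R" "u \<in> S"
  shows "fraction R S a s \<oplus>\<^bsub>localization R S\<^esub> fraction R S b u =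
    fraction R S (u \<otimes> a \<oplus> s \<otimes> b) (s \<otimes> u)"
  unfolding localization_def monoid.select_convs ring.select_convs using assms
  by - ((rule UN_fraction, assumption, assumption)+, rule fraction_add_cong, assumption+)

lemma one_localization: "\<one>\<^bsub>localization R S\<^esub> = fraction R S \<one> \<one>"
  and zero_localization: "\<zero>\<^bsub>localization R S\<^esub> = fraction R S \<zero> \<one>"
  by (simp_all add: localization_def)

lemma cring_localization: "cring (localization R S)"
proof (rule cringI)
  show "abelian_group (localization R S)"
  proof (rule abelian_groupI)
    show "\<zero>\<^bsub>localization R S\<^esub> \<in> carrier (localization R S)"
      by (simp add: zero_localization S_one)
  next
    fix X Y assume "X \<in> carrier (localization R S)" "Y \<in> carrier (localization R S)"
    then obtain a s b u where "a \<in> carrier R" "s \<in> S" "X = fraction R S a s"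
      "b \<in> carrier R" "u \<in> S" "Y = fraction R S b u" by (meson fractionE)
    then show "X \<oplus>\<^bsub>localization R S\<^esub> Y \<in> carrier (localization R S)"
      "X \<oplus>\<^bsub>localization R S\<^esub> Y = Y \<oplus>\<^bsub>localization R S\<^esub> X"
      by (simp_all add: S_mult m_comm a_comm)
  next
    fix X assume "X \<in> carrier (localization R S)"
    then obtain a s where X: "a \<in> carrier R" "s \<in> S" "X = fraction R S a s" by (rule fractionE)
    then show "\<zero>\<^bsub>localization R S\<^esub> \<oplus>\<^bsub>localization R S\<^esub> X = X"
      by (simp add: zero_localization S_one)
    \<comment> \<open>Adding \<open>X\<close> to its candidate negative produces the denominator
      \<open>s \<otimes> s\<close>, so this zero must be identified with the chosen one over
      \<open>\<one>\<close>.\<close>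
    have "fraction R S \<zero> (s \<otimes> s) = fraction R S \<zero> \<one>"
      by (rule fraction_eqI) (use X S_one S_mult in simp_all)
    with X have "fraction R S (\<ominus> a) s \<oplus>\<^bsub>localization R S\<^esub> X = \<zero>\<^bsub>localization R S\<^esub>"
      by (simp add: zero_localization r_minus l_neg)
    then show "\<exists>Y\<in>carrier (localization R S). Y \<oplus>\<^bsub>localization R S\<^esub> X = \<zero>\<^bsub>localization R S\<^esub>"
      by (rule bexI) (use X in simp_all)
  next
    fix X Y Z assume "X \<in> carrier (localization R S)" "Y \<in> carrier (localization R S)"
      "Z \<in> carrier (localization R S)"
    then obtain a s b u c w where "a \<in> carrier R" "s \<in> S" "X = fraction R S a s"
      "b \<in> carrier R" "u \<in> S" "Y = fraction R S b u"
      "c \<in> carrier R" "w \<in> S" "Z = fraction R S c w" by (meson fractionE)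
    then show "X \<oplus>\<^bsub>localization R S\<^esub> Y \<oplus>\<^bsub>localization R S\<^esub> Z =
      X \<oplus>\<^bsub>localization R S\<^esub> (Y \<oplus>\<^bsub>localization R S\<^esub> Z)"
      by (simp add: S_mult m_ac r_distr a_ac)
  qed
  show "Group.comm_monoid (localization R S)"
  proof (rule comm_monoidI)
    show "\<one>\<^bsub>localization R S\<^esub> \<in> carrier (localization R S)"
      by (simp add: one_localization S_one)
  next
    fix X assume "X \<in> carrier (localization R S)"
    then obtain a s where "a \<in> carrier R" "s \<in> S" "X = fraction R S a s" by (rule fractionE)
    then show "\<one>\<^bsub>localization R S\<^esub> \<otimes>\<^bsub>localization R S\<^esub> X = X"
      by (simp add: one_localization S_one)
  next
    fix X Y assume "X \<in> carrier (localization R S)" "Y \<in> carrier (localization R S)"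
    then obtain a s b u where "a \<in> carrier R" "s \<in> S" "X = fraction R S a s"
      "b \<in> carrier R" "u \<in> S" "Y = fraction R S b u" by (meson fractionE)
    then show "X \<otimes>\<^bsub>localization R S\<^esub> Y \<in> carrier (localization R S)"
      "X \<otimes>\<^bsub>localization R S\<^esub> Y = Y \<otimes>\<^bsub>localization R S\<^esub> X"
      by (simp_all add: S_mult m_comm)
  next
    fix X Y Z assume "X \<in> carrier (localization R S)" "Y \<in> carrier (localization R S)"
      "Z \<in> carrier (localization R S)"
    then obtain a s b u c w where "a \<in> carrier R" "s \<in> S" "X = fraction R S a s"
      "b \<in> carrier R" "u \<in> S" "Y = fraction R S b u"
      "c \<in> carrier R" "w \<in> S" "Z = fraction R S c w" by (meson fractionE)
    then show "X \<otimes>\<^bsub>localization R S\<^esub> Y \<otimes>\<^bsub>localization R S\<^esub> Z =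
      X \<otimes>\<^bsub>localization R S\<^esub> (Y \<otimes>\<^bsub>localization R S\<^esub> Z)"
      by (simp add: S_mult m_assoc)
  qed
  fix X Y Z assume "X \<in> carrier (localization R S)" "Y \<in> carrier (localization R S)"
    "Z \<in> carrier (localization R S)"
  then obtain a s b u c w where C: "a \<in> carrier R" "s \<in> S" "b \<in> carrier R" "u \<in> S"
      "c \<in> carrier R" "w \<in> S"
    and XYZ: "X = fraction R S a s" "Y = fraction R S b u" "Z = fraction R S c w"
    by (meson fractionE)
  \<comment> \<open>The two sides of the distributive law are computed with denominators that differ
    by a factor \<open>w\<close>; the numerators differ by the same factor.\<close>
  have "fraction R S ((u \<otimes> a \<oplus> s \<otimes> b) \<otimes> c) (s \<otimes> u \<otimes> w) =
      fraction R S (u \<otimes> w \<otimes> (a \<otimes> c) \<oplus> s \<otimes> w \<otimes> (b \<otimes> c)) (s \<otimes> w \<otimes> (u \<otimes> w))"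
    by (rule fraction_eqI) (use C in \<open>simp_all add: S_mult m_ac r_distr\<close>)
  then show "(X \<oplus>\<^bsub>localization R S\<^esub> Y) \<otimes>\<^bsub>localization R S\<^esub> Z =
    X \<otimes>\<^bsub>localization R S\<^esub> Z \<oplus>\<^bsub>localization R S\<^esub> Y \<otimes>\<^bsub>localization R S\<^esub> Z"
    using C by (simp add: XYZ S_mult)
qed

end

text \<open>
  Weaker than \<^const>\<open>algebra\<close>: additivity of the scalar action is irrelevant for localizing it,
  so the module axioms need not be checked for Laurent polynomials and contraction algebras.
\<close>
definition scalars_multiplicative :: "('k, 'r) ring_scheme \<Rightarrow> ('k, 'a, 'm) module_scheme \<Rightarrow> bool"
  where "scalars_multiplicative K R \<longleftrightarrow> (\<forall>c\<in>carrier K. \<forall>x\<in>carrier R. c \<odot>\<^bsub>R\<^esub> x \<in> carrier R \<and>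
    (\<forall>y\<in>carrier R. (c \<odot>\<^bsub>R\<^esub> x) \<otimes>\<^bsub>R\<^esub> y = c \<odot>\<^bsub>R\<^esub> (x \<otimes>\<^bsub>R\<^esub> y)))"

lemma scalars_multiplicativeD:
  assumes "scalars_multiplicative K R" "c \<in> carrier K" "x \<in> carrier R"
  shows "c \<odot>\<^bsub>R\<^esub> x \<in> carrier R"
    and "y \<in> carrier R \<Longrightarrow> (c \<odot>\<^bsub>R\<^esub> x) \<otimes>\<^bsub>R\<^esub> y = c \<odot>\<^bsub>R\<^esub> (x \<otimes>\<^bsub>R\<^esub> y)"
  using assms unfolding scalars_multiplicative_def by blast+

lemma (in algebra) scalars_multiplicative: "scalars_multiplicative R M"
  by (simp add: scalars_multiplicative_def smult_assoc2)

text \<open>Only linearity of the inverse is new compared with ring isomorphisms: apply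
  \<open>h\<close> to both sides and use injectivity, which is available because \<open>A\<close> is
  closed under scalars.\<close>

lemma algebra_iso_sym:
  assumes "cring A" "scalars_multiplicative K A" and h: "h \<in> algebra_iso K A B"
  shows "inv_into (carrier A) h \<in> algebra_iso K B A"
proof -
  interpret cring A by fact
  have iso: "h \<in> ring_iso A B"
    and lin: "\<And>c a. c \<in> carrier K \<Longrightarrow> a \<in> carrier A \<Longrightarrow> h (c \<odot>\<^bsub>A\<^esub> a) = c \<odot>\<^bsub>B\<^esub> h a"
    using h by (auto simp: algebra_iso_def)
  have bij: "bij_betw h (carrier A) (carrier B)" using iso by (simp add: ring_iso_def)
  have "inv_into (carrier A) h (c \<odot>\<^bsub>B\<^esub> b) = c \<odot>\<^bsub>A\<^esub> inv_into (carrier A) h b"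
    if "c \<in> carrier K" "b \<in> carrier B" for c b
  proof -
    let ?a = "inv_into (carrier A) h b"
    have a: "?a \<in> carrier A" "h ?a = b"
      using bij that by (auto simp: bij_betw_def inv_into_into f_inv_into_f)
    have "h (c \<odot>\<^bsub>A\<^esub> ?a) = c \<odot>\<^bsub>B\<^esub> b" using lin[OF that(1) a(1)] a(2) by simp
    then show ?thesis
      using bij_betw_inv_into_left[OF bij] scalars_multiplicativeD(1)[OF assms(2) that(1) a(1)] by metis
  qed
  then show ?thesis
    using ring_iso_set_sym[OF ring_axioms iso] by (simp add: algebra_iso_def)
qed

lemma algebra_isomorphic_sym:
  assumes "cring A" "scalars_multiplicative K A" "algebra_isomorphic K A B"
  shows "algebra_isomorphic K B A"
  using assms algebra_iso_sym unfolding algebra_isomorphic_def by blast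

lemma fraction_ring_powers:
  assumes "cring R" "f \<in> carrier R"
  shows "fraction_ring R (powers R f)"
proof -
  interpret cring R by fact
  show ?thesis
  proof unfold_locales
    show "powers R f \<subseteq> carrier R" using assms(2) by (auto simp: powers_def)
    show "\<one>\<^bsub>R\<^esub> \<in> powers R f"
      unfolding powers_def by (rule range_eqI[of _ _ 0]) simp
    show "s \<otimes>\<^bsub>R\<^esub> u \<in> powers R f" if "s \<in> powers R f" "u \<in> powers R f" for s u
      using that assms(2) nat_pow_mult[OF assms(2)] unfolding powers_def by auto
  qed
qed

section \<open>Scalar action on fractions and a recognition criterion for localizations\<close>

context fraction_ring
begin

text \<open>A witness \<open>v\<close> for the equality of two fractions remains one after scaling,
  because scalars can be moved past products.\<close>

lemma smult_fraction:
  assumes K: "scalars_multiplicative K R" "c \<in> carrier K" and a: "a \<in> carrier R" "s \<in> S"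
  shows "c \<odot>\<^bsub>localization R S\<^esub> fraction R S a s = fraction R S (c \<odot>\<^bsub>R\<^esub> a) s"
proof -
  note D = scalars_multiplicativeD[OF K]
  have R: "x \<otimes> (c \<odot>\<^bsub>R\<^esub> y) = c \<odot>\<^bsub>R\<^esub> (x \<otimes> y)" if "x \<in> carrier R" "y \<in> carrier R" for x y
    using that D by (metis m_comm)
  have "fraction R S (c \<odot>\<^bsub>R\<^esub> b) u = fraction R S (c \<odot>\<^bsub>R\<^esub> a) s"
    if b: "b \<in> carrier R" "u \<in> S" and eq: "fraction R S b u = fraction R S a s" for b u
  proof -
    obtain v where "v \<in> S" "v \<otimes> (s \<otimes> b) = v \<otimes> (u \<otimes> a)"
      using eq unfolding fraction_eq_iff[OF b a] by blast
    then have "v \<otimes> (s \<otimes> (c \<odot>\<^bsub>R\<^esub> b)) = v \<otimes> (u \<otimes> (c \<odot>\<^bsub>R\<^esub> a))"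
      using b a by (simp add: R)
    then show ?thesis using b a D(1) \<open>v \<in> S\<close> by (auto simp: fraction_eq_iff)
  qed
  then show ?thesis
    unfolding localization_def module.select_convs using a by - (rule UN_fraction)
qed

lemma algebra_localization:
  assumes "algebra K R"
  shows "algebra K (localization R S)"
proof -
  interpret K: algebra K R by fact
  note sm = smult_fraction[OF K.scalars_multiplicative]
  show ?thesis
  proof (rule algebraI)
    show "cring K" by (rule K.R_cring)
    show "cring (localization R S)" by (rule cring_localization)
  next
    fix c X assume "c \<in> carrier K" "X \<in> carrier (localization R S)"
    then show "c \<odot>\<^bsub>localization R S\<^esub> X \<in> carrier (localization R S)"
      by (elim fractionE) (simp add: sm)
  next
    fix c d X assume cd: "c \<in> carrier K" "d \<in> carrier K" and "X \<in> carrier (localization R S)"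
    then obtain a s where a: "a \<in> carrier R" "s \<in> S" "X = fraction R S a s"
      by (elim fractionE)
    show "(c \<otimes>\<^bsub>K\<^esub> d) \<odot>\<^bsub>localization R S\<^esub> X =
        c \<odot>\<^bsub>localization R S\<^esub> (d \<odot>\<^bsub>localization R S\<^esub> X)"
      using cd a by (simp add: sm K.smult_assoc1)
    have "fraction R S (c \<odot>\<^bsub>R\<^esub> a \<oplus> d \<odot>\<^bsub>R\<^esub> a) s =
        fraction R S (s \<otimes> (c \<odot>\<^bsub>R\<^esub> a) \<oplus> s \<otimes> (d \<odot>\<^bsub>R\<^esub> a)) (s \<otimes> s)"
      by (rule fraction_eqI) (use cd a in \<open>simp_all add: S_mult r_distr m_assoc\<close>)
    then show "(c \<oplus>\<^bsub>K\<^esub> d) \<odot>\<^bsub>localization R S\<^esub> X =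
        c \<odot>\<^bsub>localization R S\<^esub> X \<oplus>\<^bsub>localization R S\<^esub> d \<odot>\<^bsub>localization R S\<^esub> X"
      using cd a by (simp add: sm K.smult_l_distr)
  next
    fix c X Y assume c: "c \<in> carrier K"
      and "X \<in> carrier (localization R S)" "Y \<in> carrier (localization R S)"
    then obtain a s b u where XY: "a \<in> carrier R" "s \<in> S" "X = fraction R S a s"
      "b \<in> carrier R" "u \<in> S" "Y = fraction R S b u" by (meson fractionE)
    have "c \<odot>\<^bsub>R\<^esub> (x \<otimes> y) = x \<otimes> (c \<odot>\<^bsub>R\<^esub> y)" if "x \<in> carrier R" "y \<in> carrier R" for x y
      using K.smult_assoc2[OF c that(2,1)] that c by (simp add: m_comm)
    then show "c \<odot>\<^bsub>localization R S\<^esub> (X \<oplus>\<^bsub>localization R S\<^esub> Y) =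
        c \<odot>\<^bsub>localization R S\<^esub> X \<oplus>\<^bsub>localization R S\<^esub> c \<odot>\<^bsub>localization R S\<^esub> Y"
      using c XY by (simp add: sm K.smult_r_distr S_mult)
    show "(c \<odot>\<^bsub>localization R S\<^esub> X) \<otimes>\<^bsub>localization R S\<^esub> Y =
        c \<odot>\<^bsub>localization R S\<^esub> (X \<otimes>\<^bsub>localization R S\<^esub> Y)"
      using c XY by (simp add: sm S_mult K.smult_assoc2)
  next
    fix X assume "X \<in> carrier (localization R S)"
    then show "\<one>\<^bsub>K\<^esub> \<odot>\<^bsub>localization R S\<^esub> X = X"
      by (elim fractionE) (simp add: sm)
  qed
qed

text \<open>Recognition criterion: \<open>T\<close> is the localization once \<open>h\<close>
  inverts \<open>S\<close>, each element of its kernel is killed by some element of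
  \<open>S\<close>, and each \<open>y\<close> becomes an image after multiplication by some
  \<open>h s\<close>. It serves both for extending the involution and for comparing the contraction
  algebras.\<close>

lemma localization_algebra_iso:
  assumes T: "cring T" and h: "h \<in> ring_hom R T" and units: "h ` S \<subseteq> Units T"
    and ker: "\<And>a. a \<in> carrier R \<Longrightarrow> h a = \<zero>\<^bsub>T\<^esub> \<Longrightarrow> \<exists>s\<in>S. s \<otimes> a = \<zero>"
    and surj: "\<And>y. y \<in> carrier T \<Longrightarrow> \<exists>a\<in>carrier R. \<exists>s\<in>S. y \<otimes>\<^bsub>T\<^esub> h s = h a"
    and K: "scalars_multiplicative K R" "scalars_multiplicative K T"
    and lin: "\<And>c a. c \<in> carrier K \<Longrightarrow> a \<in> carrier R \<Longrightarrow> h (c \<odot>\<^bsub>R\<^esub> a) = c \<odot>\<^bsub>T\<^esub> h a"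
  obtains \<phi> where "\<phi> \<in> algebra_iso K (localization R S) T"
    and "\<And>a s. a \<in> carrier R \<Longrightarrow> s \<in> S \<Longrightarrow> \<phi> (fraction R S a s) = h a \<otimes>\<^bsub>T\<^esub> inv\<^bsub>T\<^esub> h s"
proof -
  interpret T: cring T by fact
  interpret h: ring_hom_cring R T h
    by unfold_locales (rule h)
  have u: "h s \<in> Units T" if "s \<in> S" for s using units that by blast
  \<comment> \<open>A class has no preferred representative, so the value is described through all
    of them; its uniqueness is the forward direction of \<open>fraction_eq\<close>.\<close>
  define \<phi> where "\<phi> X = (THE y. \<exists>a\<in>carrier R. \<exists>s\<in>S. X = fraction R S a s \<and> y = h a \<otimes>\<^bsub>T\<^esub> inv\<^bsub>T\<^esub> h s)" for X
  \<comment> \<open>Multiplying both sides by the unit \<open>h s \<otimes> h w\<close> clears the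
    two inverses.\<close>
  have cross: "h a \<otimes>\<^bsub>T\<^esub> inv\<^bsub>T\<^esub> h s = h b \<otimes>\<^bsub>T\<^esub> inv\<^bsub>T\<^esub> h w \<longleftrightarrow> h (w \<otimes> a) = h (s \<otimes> b)"
    if "a \<in> carrier R" "s \<in> S" "b \<in> carrier R" "w \<in> S" for a s b w
  proof -
    have "h a \<otimes>\<^bsub>T\<^esub> inv\<^bsub>T\<^esub> h s = h b \<otimes>\<^bsub>T\<^esub> inv\<^bsub>T\<^esub> h w \<longleftrightarrow>
      (h s \<otimes>\<^bsub>T\<^esub> h w) \<otimes>\<^bsub>T\<^esub> (h a \<otimes>\<^bsub>T\<^esub> inv\<^bsub>T\<^esub> h s) = (h s \<otimes>\<^bsub>T\<^esub> h w) \<otimes>\<^bsub>T\<^esub> (h b \<otimes>\<^bsub>T\<^esub> inv\<^bsub>T\<^esub> h w)"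
      using that u by (intro T.Units_l_cancel[symmetric]) auto
    also have "(h s \<otimes>\<^bsub>T\<^esub> h w) \<otimes>\<^bsub>T\<^esub> (h a \<otimes>\<^bsub>T\<^esub> inv\<^bsub>T\<^esub> h s) = (h s \<otimes>\<^bsub>T\<^esub> inv\<^bsub>T\<^esub> h s) \<otimes>\<^bsub>T\<^esub> (h w \<otimes>\<^bsub>T\<^esub> h a)"
      using that u by (simp add: T.m_ac del: T.Units_r_inv T.Units_l_inv)
    also have "\<dots> = h (w \<otimes> a)" using that u by simp
    also have "(h s \<otimes>\<^bsub>T\<^esub> h w) \<otimes>\<^bsub>T\<^esub> (h b \<otimes>\<^bsub>T\<^esub> inv\<^bsub>T\<^esub> h w) = (h w \<otimes>\<^bsub>T\<^esub> inv\<^bsub>T\<^esub> h w) \<otimes>\<^bsub>T\<^esub> (h s \<otimes>\<^bsub>T\<^esub> h b)"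
      using that u by (simp add: T.m_ac del: T.Units_r_inv T.Units_l_inv)
    also have "\<dots> = h (s \<otimes> b)" using that u by simp
    finally show ?thesis .
  qed
  have fraction_eq: "fraction R S a s = fraction R S b w \<longleftrightarrow> h a \<otimes>\<^bsub>T\<^esub> inv\<^bsub>T\<^esub> h s = h b \<otimes>\<^bsub>T\<^esub> inv\<^bsub>T\<^esub> h w"
    if C: "a \<in> carrier R" "s \<in> S" "b \<in> carrier R" "w \<in> S" for a s b w
  proof
    assume "fraction R S a s = fraction R S b w"
    then obtain v where v: "v \<in> S" "v \<otimes> (w \<otimes> a) = v \<otimes> (s \<otimes> b)" using C by (auto simp: fraction_eq_iff)
    then have "h v \<otimes>\<^bsub>T\<^esub> h (w \<otimes> a) = h v \<otimes>\<^bsub>T\<^esub> h (s \<otimes> b)"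
      using C by (metis S_carrier h.hom_mult m_closed)
    then show "h a \<otimes>\<^bsub>T\<^esub> inv\<^bsub>T\<^esub> h s = h b \<otimes>\<^bsub>T\<^esub> inv\<^bsub>T\<^esub> h w"
      unfolding cross[OF C] using T.Units_l_cancel[OF u[OF v(1)]] C
      by (metis S_carrier h.hom_closed m_closed)
  next
    assume "h a \<otimes>\<^bsub>T\<^esub> inv\<^bsub>T\<^esub> h s = h b \<otimes>\<^bsub>T\<^esub> inv\<^bsub>T\<^esub> h w"
    then have "h (w \<otimes> a) = h (s \<otimes> b)" unfolding cross[OF C] .
    \<comment> \<open>Injectivity: the difference of the cross products lies in the kernel, and the
      element of \<open>S\<close> killing it is the witness for equality of the fractions.\<close>
    then have "h (w \<otimes> a \<oplus> \<ominus> (s \<otimes> b)) = \<zero>\<^bsub>T\<^esub>" using C by (simp add: T.r_neg del: h.hom_mult)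
    moreover have "w \<otimes> a \<oplus> \<ominus> (s \<otimes> b) \<in> carrier R" using C by simp
    ultimately obtain v where v: "v \<in> S" "v \<otimes> (w \<otimes> a \<oplus> \<ominus> (s \<otimes> b)) = \<zero>" using ker by blast
    then have "v \<otimes> (w \<otimes> a) \<ominus> v \<otimes> (s \<otimes> b) = \<zero>" using C by (simp add: minus_eq r_distr r_minus)
    then have "v \<otimes> (w \<otimes> a) = v \<otimes> (s \<otimes> b)" using C v by (simp add: r_right_minus_eq)
    then show "fraction R S a s = fraction R S b w" using C v by (auto simp: fraction_eq_iff)
  qed
  have \<phi>: "\<phi> (fraction R S a s) = h a \<otimes>\<^bsub>T\<^esub> inv\<^bsub>T\<^esub> h s" if "a \<in> carrier R" "s \<in> S" for a s
    unfolding \<phi>_def using that fraction_eq by (intro the_equality) blast+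
  have "\<phi> \<in> ring_iso (localization R S) T"
  proof (rule ring_iso_memI)
    fix X assume "X \<in> carrier (localization R S)"
    then show "\<phi> X \<in> carrier T" by (elim fractionE) (simp add: \<phi> u)
  next
    fix X Y assume "X \<in> carrier (localization R S)" "Y \<in> carrier (localization R S)"
    then obtain a s b w where C: "a \<in> carrier R" "s \<in> S" "X = fraction R S a s"
      "b \<in> carrier R" "w \<in> S" "Y = fraction R S b w" by (meson fractionE)
    have i: "inv\<^bsub>T\<^esub> (h s \<otimes>\<^bsub>T\<^esub> h w) = inv\<^bsub>T\<^esub> h s \<otimes>\<^bsub>T\<^esub> inv\<^bsub>T\<^esub> h w"
    proof (rule T.comm_inv_char)
      have "h s \<otimes>\<^bsub>T\<^esub> h w \<otimes>\<^bsub>T\<^esub> (inv\<^bsub>T\<^esub> h s \<otimes>\<^bsub>T\<^esub> inv\<^bsub>T\<^esub> h w) =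
        (h s \<otimes>\<^bsub>T\<^esub> inv\<^bsub>T\<^esub> h s) \<otimes>\<^bsub>T\<^esub> (h w \<otimes>\<^bsub>T\<^esub> inv\<^bsub>T\<^esub> h w)"
        using C u by (simp add: T.m_ac del: T.Units_r_inv T.Units_l_inv)
      then show "h s \<otimes>\<^bsub>T\<^esub> h w \<otimes>\<^bsub>T\<^esub> (inv\<^bsub>T\<^esub> h s \<otimes>\<^bsub>T\<^esub> inv\<^bsub>T\<^esub> h w) = \<one>\<^bsub>T\<^esub>"
        using C u by simp
    qed (use C u in auto)
    show "\<phi> (X \<otimes>\<^bsub>localization R S\<^esub> Y) = \<phi> X \<otimes>\<^bsub>T\<^esub> \<phi> Y"
      using C u by (simp add: \<phi> S_mult i T.m_ac)
    \<comment> \<open>Each summand carries a factor of the form unit times inverse, which brings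
      both to the common denominator; these factors cancel in the next step.\<close>
    have "\<phi> (X \<oplus>\<^bsub>localization R S\<^esub> Y) =
      (h w \<otimes>\<^bsub>T\<^esub> inv\<^bsub>T\<^esub> h w) \<otimes>\<^bsub>T\<^esub> (h a \<otimes>\<^bsub>T\<^esub> inv\<^bsub>T\<^esub> h s) \<oplus>\<^bsub>T\<^esub> (h s \<otimes>\<^bsub>T\<^esub> inv\<^bsub>T\<^esub> h s) \<otimes>\<^bsub>T\<^esub> (h b \<otimes>\<^bsub>T\<^esub> inv\<^bsub>T\<^esub> h w)"
      using C u by (simp add: \<phi> S_mult i T.m_ac T.r_distr del: T.Units_r_inv T.Units_l_inv)
    then show "\<phi> (X \<oplus>\<^bsub>localization R S\<^esub> Y) = \<phi> X \<oplus>\<^bsub>T\<^esub> \<phi> Y"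
      using C u by (simp add: \<phi>)
  next
    show "\<phi> \<one>\<^bsub>localization R S\<^esub> = \<one>\<^bsub>T\<^esub>"
      by (simp add: one_localization \<phi> S_one)
  next
    show "bij_betw \<phi> (carrier (localization R S)) (carrier T)"
    proof (rule bij_betw_imageI)
      show "inj_on \<phi> (carrier (localization R S))"
        by (rule inj_onI) (elim fractionE, simp add: \<phi> fraction_eq)
      have "y \<in> \<phi> ` carrier (localization R S)" if y: "y \<in> carrier T" for y
      proof -
        obtain a s where as: "a \<in> carrier R" "s \<in> S" "y \<otimes>\<^bsub>T\<^esub> h s = h a" using surj[OF y] by blast
        have "\<phi> (fraction R S a s) = y \<otimes>\<^bsub>T\<^esub> (h s \<otimes>\<^bsub>T\<^esub> inv\<^bsub>T\<^esub> h s)"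
          unfolding \<phi>[OF as(1,2)] as(3)[symmetric] using y as(2) u by (intro T.m_assoc) auto
        then have "\<phi> (fraction R S a s) = y" using y as(2) u by simp
        then show ?thesis using as by blast
      qed
      moreover have "\<phi> ` carrier (localization R S) \<subseteq> carrier T"
        by (auto elim!: fractionE simp: \<phi> u)
      ultimately show "\<phi> ` carrier (localization R S) = carrier T" by blast
    qed
  qed
  moreover have "\<phi> (c \<odot>\<^bsub>localization R S\<^esub> X) = c \<odot>\<^bsub>T\<^esub> \<phi> X"
    if c: "c \<in> carrier K" and X: "X \<in> carrier (localization R S)" for c X
  proof -
    obtain a s where as: "a \<in> carrier R" "s \<in> S" "X = fraction R S a s"
      using X by (rule fractionE)
    then show ?thesis
      using c u by (simp add: smult_fraction[OF K(1)] \<phi> lin scalars_multiplicativeD[OF K(1)]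
        scalars_multiplicativeD(2)[OF K(2)])
  qed
  ultimately have "\<phi> \<in> algebra_iso K (localization R S) T" by (simp add: algebra_iso_def)
  then show thesis by (rule that) (rule \<phi>)
qed

text \<open>Needed to invert the isomorphism out of a localized contraction algebra by means of
  \<open>algebra_isomorphic_sym\<close>.\<close>

lemma scalars_multiplicative_localization:
  assumes "scalars_multiplicative K R"
  shows "scalars_multiplicative K (localization R S)"
  unfolding scalars_multiplicative_def
proof (intro ballI conjI)
  fix c X assume c: "c \<in> carrier K" and X: "X \<in> carrier (localization R S)"
  note sm = smult_fraction[OF assms c] scalars_multiplicativeD[OF assms c]
  show "c \<odot>\<^bsub>localization R S\<^esub> X \<in> carrier (localization R S)"
    using X by (elim fractionE) (simp add: sm)
  fix Y assume "Y \<in> carrier (localization R S)"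
  with X show "(c \<odot>\<^bsub>localization R S\<^esub> X) \<otimes>\<^bsub>localization R S\<^esub> Y =
      c \<odot>\<^bsub>localization R S\<^esub> (X \<otimes>\<^bsub>localization R S\<^esub> Y)"
    by (elim fractionE) (simp add: sm S_mult)
qed

end


section \<open>The ring of Laurent polynomials\<close>

text \<open>Interchange of finite sums, by induction on the outer index set. It carries the
  associativity of the convolution product.\<close>

lemma (in abelian_monoid) finsum_swap:
  assumes "finite I" "finite J" "\<And>i j. i \<in> I \<Longrightarrow> j \<in> J \<Longrightarrow> f i j \<in> carrier G"
  shows "(\<Oplus>i\<in>I. \<Oplus>j\<in>J. f i j) = (\<Oplus>j\<in>J. \<Oplus>i\<in>I. f i j)"
  using assms(1,3)
proof (induction I)
  case empty
  then show ?case by (simp add: finsum_zero)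
next
  case (insert i I)
  have "(\<Oplus>j\<in>J. \<Oplus>i\<in>insert i I. f i j) = (\<Oplus>j\<in>J. f i j \<oplus> (\<Oplus>i\<in>I. f i j))"
    using insert by (intro finsum_cong') (auto simp: Pi_def)
  also have "\<dots> = (\<Oplus>j\<in>J. f i j) \<oplus> (\<Oplus>j\<in>J. \<Oplus>i\<in>I. f i j)"
    using insert by (intro finsum_addf) (auto simp: Pi_def)
  finally show ?case using insert by (simp add: Pi_def)
qed

locale laurent_coefficients = cring R
  for K :: "('k, 'r) ring_scheme" and R :: "('k, 'a, 'm) module_scheme" (structure)
begin

abbreviation L where "L \<equiv> laurent K R"

lemma laurent_carrier_iff:
  "p \<in> carrier L \<longleftrightarrow> (\<forall>n. p n \<in> carrier R) \<and> finite {n. p n \<noteq> \<zero>}"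
  by (auto simp: laurent_def)

lemma laurent_coeff_closed [simp, intro]: "p \<in> carrier L \<Longrightarrow> p n \<in> carrier R"
  and laurent_finite_support: "p \<in> carrier L \<Longrightarrow> finite {n. p n \<noteq> \<zero>}"
  by (auto simp: laurent_carrier_iff)

lemma laurent_one: "\<one>\<^bsub>L\<^esub> = laurent_monom R \<one> 0"
  and laurent_zero: "\<zero>\<^bsub>L\<^esub> = (\<lambda>n. \<zero>)"
  and laurent_add: "p \<oplus>\<^bsub>L\<^esub> q = (\<lambda>n. p n \<oplus> q n)"
  by (simp_all add: laurent_def laurent_monom_def)

lemma laurent_monom_closed [simp, intro]:
  assumes "a \<in> carrier R"
  shows "laurent_monom R a m \<in> carrier L"
proof -
  have "{n. laurent_monom R a m n \<noteq> \<zero>} \<subseteq> {m}" by (auto simp: laurent_monom_def)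
  then have "finite {n. laurent_monom R a m n \<noteq> \<zero>}" by (rule finite_subset) simp
  with assms show ?thesis by (auto simp: laurent_carrier_iff laurent_monom_def)
qed

text \<open>The product is defined by a sum over the exact support of \<open>p\<close>. Extra
  indices contribute zero, so sums for different products can be compared over one common finite
  set.\<close>

lemma laurent_mult_eq:
  assumes pq: "p \<in> carrier L" "q \<in> carrier L" and I: "finite I" "{i. p i \<noteq> \<zero>} \<subseteq> I"
  shows "(p \<otimes>\<^bsub>L\<^esub> q) n = (\<Oplus>i\<in>I. p i \<otimes> q (n - i))"
proof -
  have "(\<Oplus>i\<in>{i. p i \<noteq> \<zero>}. p i \<otimes> q (n - i)) = (\<Oplus>i\<in>I. p i \<otimes> q (n - i))"
    using I pq by (intro add.finprod_mono_neutral_cong_left) (auto simp: Pi_def)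
  then show ?thesis by (simp add: laurent_def)
qed

lemma laurent_mult_commute:
  assumes pq: "p \<in> carrier L" "q \<in> carrier L"
  shows "p \<otimes>\<^bsub>L\<^esub> q = q \<otimes>\<^bsub>L\<^esub> p"
proof
  fix n :: int
  let ?Q = "{j. q j \<noteq> \<zero>}" and ?P = "{i. p i \<noteq> \<zero>}"
  \<comment> \<open>This set contains the support of \<open>p\<close>, and its reflection under
    subtraction from \<open>n\<close> contains the support of \<open>q\<close>. So both products can
    be summed over it.\<close>
  let ?I = "?P \<union> (\<lambda>j. n - j) ` ?Q"
  have fin: "finite ?I" using pq by (simp add: laurent_finite_support)
  have inj: "inj_on (\<lambda>i. n - i) ?I" by (rule inj_onI) simp
  have "(q \<otimes>\<^bsub>L\<^esub> p) n = (\<Oplus>j\<in>(\<lambda>i. n - i) ` ?I. q j \<otimes> p (n - j))"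
    using pq fin by (intro laurent_mult_eq) (auto simp: image_Un image_image laurent_finite_support)
  also have "\<dots> = (\<Oplus>i\<in>?I. q (n - i) \<otimes> p (n - (n - i)))"
    using pq inj by (intro finsum_reindex) (auto simp: Pi_def)
  also have "\<dots> = (\<Oplus>i\<in>?I. p i \<otimes> q (n - i))"
    using pq by (intro finsum_cong') (auto simp: Pi_def m_comm)
  also have "\<dots> = (p \<otimes>\<^bsub>L\<^esub> q) n"
    using pq fin by (intro laurent_mult_eq[symmetric]) auto
  finally show "(p \<otimes>\<^bsub>L\<^esub> q) n = (q \<otimes>\<^bsub>L\<^esub> p) n" by simp
qed

text \<open>A nonzero coefficient at \<open>n\<close> requires a nonzero term, hence exponents
  \<open>i\<close> and \<open>n - i\<close> in the two supports. This gives finiteness and the index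
  set for associativity.\<close>

lemma laurent_mult_support:
  assumes pq: "p \<in> carrier L" "q \<in> carrier L"
  shows "{n. (p \<otimes>\<^bsub>L\<^esub> q) n \<noteq> \<zero>} \<subseteq> (\<lambda>(i, j). i + j) ` ({i. p i \<noteq> \<zero>} \<times> {j. q j \<noteq> \<zero>})"
proof
  fix n assume "n \<in> {n. (p \<otimes>\<^bsub>L\<^esub> q) n \<noteq> \<zero>}"
  then have "(\<Oplus>i\<in>{i. p i \<noteq> \<zero>}. p i \<otimes> q (n - i)) \<noteq> \<zero>" by (simp add: laurent_def)
  then obtain i where "p i \<otimes> q (n - i) \<noteq> \<zero>"
    using add.finprod_one_eqI[of "{i. p i \<noteq> \<zero>}" "\<lambda>i. p i \<otimes> q (n - i)"] by auto
  then have "p i \<noteq> \<zero>" "q (n - i) \<noteq> \<zero>" using pq by auto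
  then show "n \<in> (\<lambda>(i, j). i + j) ` ({i. p i \<noteq> \<zero>} \<times> {j. q j \<noteq> \<zero>})"
    by (intro image_eqI[of _ _ "(i, n - i)"]) auto
qed

lemma laurent_mult_closed [simp, intro]:
  assumes pq: "p \<in> carrier L" "q \<in> carrier L"
  shows "p \<otimes>\<^bsub>L\<^esub> q \<in> carrier L"
proof -
  have "finite {n. (p \<otimes>\<^bsub>L\<^esub> q) n \<noteq> \<zero>}"
    by (rule finite_subset[OF laurent_mult_support[OF pq]]) (use pq in \<open>simp add: laurent_finite_support\<close>)
  moreover have "(p \<otimes>\<^bsub>L\<^esub> q) n \<in> carrier R" for n
    using pq by (auto simp: laurent_def Pi_def)
  ultimately show ?thesis by (simp add: laurent_carrier_iff)
qed

lemma laurent_add_closed [simp, intro]: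
  assumes "p \<in> carrier L" "q \<in> carrier L"
  shows "p \<oplus>\<^bsub>L\<^esub> q \<in> carrier L"
proof -
  have "{n. (p \<oplus>\<^bsub>L\<^esub> q) n \<noteq> \<zero>} \<subseteq> {n. p n \<noteq> \<zero>} \<union> {n. q n \<noteq> \<zero>}" by (auto simp: laurent_add)
  then have "finite {n. (p \<oplus>\<^bsub>L\<^esub> q) n \<noteq> \<zero>}"
    by (rule finite_subset) (use assms in \<open>simp add: laurent_finite_support\<close>)
  then show ?thesis using assms by (auto simp: laurent_carrier_iff laurent_add)
qed

lemma laurent_mult_assoc:
  assumes pqr: "p \<in> carrier L" "q \<in> carrier L" "r \<in> carrier L"
  shows "p \<otimes>\<^bsub>L\<^esub> q \<otimes>\<^bsub>L\<^esub> r = p \<otimes>\<^bsub>L\<^esub> (q \<otimes>\<^bsub>L\<^esub> r)"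
proof
  fix n :: int
  let ?P = "{i. p i \<noteq> \<zero>}" and ?Q = "{j. q j \<noteq> \<zero>}"
  let ?I = "(\<lambda>(i, j). i + j) ` (?P \<times> ?Q)"
  have fin: "finite ?P" "finite ?I" using pqr by (simp_all add: laurent_finite_support)
  have "(p \<otimes>\<^bsub>L\<^esub> q \<otimes>\<^bsub>L\<^esub> r) n = (\<Oplus>i\<in>?I. (p \<otimes>\<^bsub>L\<^esub> q) i \<otimes> r (n - i))"
    using pqr fin by (intro laurent_mult_eq laurent_mult_support) auto
  also have "\<dots> = (\<Oplus>i\<in>?I. \<Oplus>j\<in>?P. p j \<otimes> (q (i - j) \<otimes> r (n - i)))"
  proof (rule finsum_cong')
    fix i assume "i \<in> ?I"
    have "(p \<otimes>\<^bsub>L\<^esub> q) i \<otimes> r (n - i) = (\<Oplus>j\<in>?P. p j \<otimes> q (i - j)) \<otimes> r (n - i)"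
      using laurent_mult_eq[OF pqr(1,2) fin(1) subset_refl] by simp
    also have "\<dots> = (\<Oplus>j\<in>?P. p j \<otimes> q (i - j) \<otimes> r (n - i))"
      using pqr fin by (intro finsum_ldistr) (auto simp: Pi_def)
    also have "\<dots> = (\<Oplus>j\<in>?P. p j \<otimes> (q (i - j) \<otimes> r (n - i)))"
      using pqr by (intro finsum_cong') (auto simp: Pi_def m_assoc)
    finally show "(p \<otimes>\<^bsub>L\<^esub> q) i \<otimes> r (n - i) = (\<Oplus>j\<in>?P. p j \<otimes> (q (i - j) \<otimes> r (n - i)))" .
  qed (use pqr in \<open>auto simp: Pi_def\<close>)
  also have "\<dots> = (\<Oplus>j\<in>?P. \<Oplus>i\<in>?I. p j \<otimes> (q (i - j) \<otimes> r (n - i)))"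
    using pqr fin by (intro finsum_swap) auto
  also have "\<dots> = (\<Oplus>j\<in>?P. p j \<otimes> (q \<otimes>\<^bsub>L\<^esub> r) (n - j))"
  proof (rule finsum_cong')
    fix j assume j: "j \<in> ?P"
    have inj: "inj_on (\<lambda>i. i - j) ?I" by (rule inj_onI) simp
    \<comment> \<open>As \<open>j\<close> lies in the support of \<open>p\<close>, shifting
      \<open>?I\<close> by \<open>j\<close> still covers the support of \<open>q\<close>; hence the
      inner sum is a full coefficient of the product of \<open>q\<close> and
      \<open>r\<close>.\<close>
    have sub: "?Q \<subseteq> (\<lambda>i. i - j) ` ?I"
    proof
      fix k assume "k \<in> ?Q"
      with j have "j + k \<in> ?I" by (intro image_eqI[of _ _ "(j, k)"]) auto
      then show "k \<in> (\<lambda>i. i - j) ` ?I" by (intro image_eqI[of _ _ "j + k"]) simp_all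
    qed
    have "(q \<otimes>\<^bsub>L\<^esub> r) (n - j) = (\<Oplus>k\<in>(\<lambda>i. i - j) ` ?I. q k \<otimes> r (n - j - k))"
      using pqr fin sub by (intro laurent_mult_eq) auto
    also have "\<dots> = (\<Oplus>i\<in>?I. q (i - j) \<otimes> r (n - j - (i - j)))"
      using pqr inj by (intro finsum_reindex) (auto simp: Pi_def)
    also have "\<dots> = (\<Oplus>i\<in>?I. q (i - j) \<otimes> r (n - i))"
      by simp
    finally show "(\<Oplus>i\<in>?I. p j \<otimes> (q (i - j) \<otimes> r (n - i))) = p j \<otimes> (q \<otimes>\<^bsub>L\<^esub> r) (n - j)"
      using pqr fin by (simp add: finsum_rdistr Pi_def)
  qed (use pqr in \<open>auto simp: Pi_def\<close>)
  also have "\<dots> = (p \<otimes>\<^bsub>L\<^esub> (q \<otimes>\<^bsub>L\<^esub> r)) n"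
    using pqr fin by (intro laurent_mult_eq[symmetric]) auto
  finally show "(p \<otimes>\<^bsub>L\<^esub> q \<otimes>\<^bsub>L\<^esub> r) n = (p \<otimes>\<^bsub>L\<^esub> (q \<otimes>\<^bsub>L\<^esub> r)) n" .
qed

lemma laurent_monom_mult:
  assumes "a \<in> carrier R" "q \<in> carrier L"
  shows "(laurent_monom R a m \<otimes>\<^bsub>L\<^esub> q) n = a \<otimes> q (n - m)"
proof -
  \<comment> \<open>For \<open>a\<close> equal to zero the support is empty, so the sum is taken
    over \<open>{m}\<close> rather than over the exact support.\<close>
  have "(laurent_monom R a m \<otimes>\<^bsub>L\<^esub> q) n = (\<Oplus>i\<in>{m}. laurent_monom R a m i \<otimes> q (n - i))"
  proof (rule laurent_mult_eq)
    show "{i. laurent_monom R a m i \<noteq> \<zero>} \<subseteq> {m}" by (auto simp: laurent_monom_def)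
  qed (use assms in auto)
  then show ?thesis using assms by (simp add: laurent_monom_def Pi_def)
qed

lemma cring_laurent: "cring L"
proof (rule cringI)
  show "abelian_group L"
  proof (rule abelian_groupI)
    fix p assume p: "p \<in> carrier L"
    have "(\<lambda>n. \<ominus> p n) \<in> carrier L"
      using p laurent_finite_support[OF p] by (simp add: laurent_carrier_iff)
    moreover have "(\<lambda>n. \<ominus> p n) \<oplus>\<^bsub>L\<^esub> p = \<zero>\<^bsub>L\<^esub>"
      using p by (simp add: laurent_add laurent_zero l_neg)
    ultimately show "\<exists>q\<in>carrier L. q \<oplus>\<^bsub>L\<^esub> p = \<zero>\<^bsub>L\<^esub>" by blast
  next
    show "\<zero>\<^bsub>L\<^esub> \<in> carrier L" by (simp add: laurent_zero laurent_carrier_iff)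
  qed (auto simp: laurent_add laurent_zero a_ac intro: laurent_add_closed[unfolded laurent_add])
  show "Group.comm_monoid L"
  proof (rule comm_monoidI)
    show "\<one>\<^bsub>L\<^esub> \<otimes>\<^bsub>L\<^esub> p = p" if "p \<in> carrier L" for p
      using that by (auto simp: laurent_one laurent_monom_mult)
    show "p \<otimes>\<^bsub>L\<^esub> q = q \<otimes>\<^bsub>L\<^esub> p" if "p \<in> carrier L" "q \<in> carrier L" for p q
      using that by (rule laurent_mult_commute)
  qed (auto simp: laurent_one laurent_mult_assoc)
  show "(p \<oplus>\<^bsub>L\<^esub> q) \<otimes>\<^bsub>L\<^esub> r = p \<otimes>\<^bsub>L\<^esub> r \<oplus>\<^bsub>L\<^esub> q \<otimes>\<^bsub>L\<^esub> r"
    if pqr: "p \<in> carrier L" "q \<in> carrier L" "r \<in> carrier L" for p q r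
  proof
    fix n
    let ?I = "{n. p n \<noteq> \<zero>} \<union> {n. q n \<noteq> \<zero>}"
    have fin: "finite ?I" using pqr by (simp add: laurent_finite_support)
    have "((p \<oplus>\<^bsub>L\<^esub> q) \<otimes>\<^bsub>L\<^esub> r) n = (\<Oplus>i\<in>?I. (p \<oplus>\<^bsub>L\<^esub> q) i \<otimes> r (n - i))"
      using pqr fin
      by (intro laurent_mult_eq) (auto simp: laurent_add intro: laurent_add_closed[unfolded laurent_add])
    also have "\<dots> = (\<Oplus>i\<in>?I. p i \<otimes> r (n - i) \<oplus> q i \<otimes> r (n - i))"
      using pqr by (intro finsum_cong') (auto simp: laurent_add l_distr)
    also have "\<dots> = (\<Oplus>i\<in>?I. p i \<otimes> r (n - i)) \<oplus> (\<Oplus>i\<in>?I. q i \<otimes> r (n - i))"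
      using pqr by (intro finsum_addf) auto
    also have "\<dots> = (p \<otimes>\<^bsub>L\<^esub> r \<oplus>\<^bsub>L\<^esub> q \<otimes>\<^bsub>L\<^esub> r) n"
      using laurent_mult_eq[OF pqr(1,3) fin, of n] laurent_mult_eq[OF pqr(2,3) fin, of n]
      by (simp add: laurent_add[of "p \<otimes>\<^bsub>L\<^esub> r"])
    finally show "((p \<oplus>\<^bsub>L\<^esub> q) \<otimes>\<^bsub>L\<^esub> r) n = (p \<otimes>\<^bsub>L\<^esub> r \<oplus>\<^bsub>L\<^esub> q \<otimes>\<^bsub>L\<^esub> r) n" .
  qed
qed

lemma laurent_monom_mult_monom:
  assumes "a \<in> carrier R" "b \<in> carrier R"
  shows "laurent_monom R a m \<otimes>\<^bsub>L\<^esub> laurent_monom R b n = laurent_monom R (a \<otimes> b) (m + n)"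
proof
  fix k
  have "(laurent_monom R a m \<otimes>\<^bsub>L\<^esub> laurent_monom R b n) k = a \<otimes> laurent_monom R b n (k - m)"
    using assms by (intro laurent_monom_mult) auto
  then show "(laurent_monom R a m \<otimes>\<^bsub>L\<^esub> laurent_monom R b n) k = laurent_monom R (a \<otimes> b) (m + n) k"
    using assms by (auto simp: laurent_monom_def)
qed

lemma laurent_monom_pow:
  assumes "a \<in> carrier R"
  shows "laurent_monom R a m [^]\<^bsub>L\<^esub> (n::nat) = laurent_monom R (a [^] n) (int n * m)"
proof (induction n)
  case 0
  then show ?case by (simp add: laurent_one nat_pow_def)
next
  case (Suc n)
  interpret L: cring L by (rule cring_laurent)
  show ?case using Suc assms by (simp add: laurent_monom_mult_monom algebra_simps)
qed

end

section \<open>The action of polynomials in t on Laurent polynomials\<close>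

context laurent_coefficients
begin

text \<open>Since t is the square of the variable, a polynomial in t acts as the Laurent polynomial
  with its coefficients at the doubled exponents, each scalar being moved into \<open>R\<close> as a
  multiple of \<open>\<one>\<close>. Statements about scalars thereby reduce to ring laws in
  \<open>L\<close>.\<close>

lemma laurent_smult_eq_mult:
  assumes "algebra K R" and c: "c \<in> carrier (UP K)" and p: "p \<in> carrier L"
  defines "\<iota> \<equiv> \<lambda>n. if 0 \<le> n \<and> even n then coeff (UP K) c (nat (n div 2)) \<odot>\<^bsub>R\<^esub> \<one> else \<zero>"
  shows "\<iota> \<in> carrier L" and "c \<odot>\<^bsub>L\<^esub> p = \<iota> \<otimes>\<^bsub>L\<^esub> p"
proof -
  interpret K: algebra K R by fact
  interpret UP: UP_cring K "UP K" by unfold_locales simp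
  let ?I = "(\<lambda>i. 2 * int i) ` {..deg K c}"
  have supp: "{n. \<iota> n \<noteq> \<zero>} \<subseteq> ?I"
  proof
    fix n assume "n \<in> {n. \<iota> n \<noteq> \<zero>}"
    then have n: "0 \<le> n" "even n" "coeff (UP K) c (nat (n div 2)) \<odot>\<^bsub>R\<^esub> \<one> \<noteq> \<zero>"
      by (auto simp: \<iota>_def split: if_splits)
    have "nat (n div 2) \<le> deg K c"
    proof (rule ccontr)
      assume "\<not> nat (n div 2) \<le> deg K c"
      then have "coeff (UP K) c (nat (n div 2)) = \<zero>\<^bsub>K\<^esub>" using c by (intro UP.deg_aboveD) auto
      with n(3) show False by simp
    qed
    then show "n \<in> ?I" using n(1,2) by (intro image_eqI[of _ _ "nat (n div 2)"]) auto
  qed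
  have \<iota>: "\<iota> n \<in> carrier R" for n using c by (simp add: \<iota>_def)
  show L: "\<iota> \<in> carrier L"
    using \<iota> finite_subset[OF supp] by (simp add: laurent_carrier_iff)
  show "c \<odot>\<^bsub>L\<^esub> p = \<iota> \<otimes>\<^bsub>L\<^esub> p"
  proof
    fix n
    have inj: "inj_on (\<lambda>i. 2 * int i) {..deg K c}" by (rule inj_onI) simp
    have "(\<iota> \<otimes>\<^bsub>L\<^esub> p) n = (\<Oplus>i\<in>?I. \<iota> i \<otimes> p (n - i))"
      by (rule laurent_mult_eq[OF L p _ supp]) simp
    also have "\<dots> = (\<Oplus>i\<in>{..deg K c}. \<iota> (2 * int i) \<otimes> p (n - 2 * int i))"
      by (rule finsum_reindex[OF _ inj]) (use \<iota> p in auto)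
    also have "\<dots> = (\<Oplus>i\<in>{..deg K c}. coeff (UP K) c i \<odot>\<^bsub>R\<^esub> p (n - 2 * int i))"
      using c p by (intro finsum_cong') (auto simp: \<iota>_def K.smult_assoc2)
    finally show "(c \<odot>\<^bsub>L\<^esub> p) n = (\<iota> \<otimes>\<^bsub>L\<^esub> p) n" by (simp add: laurent_def)
  qed
qed

lemma scalars_multiplicative_laurent:
  assumes "algebra K R"
  shows "scalars_multiplicative (UP K) L"
proof -
  interpret L: cring L by (rule cring_laurent)
  show ?thesis
    unfolding scalars_multiplicative_def
    by (auto simp: laurent_smult_eq_mult[OF assms] L.m_assoc)
qed

text \<open>The scalar is the j-th power of t. This rule later places the odd element F in the
  contraction algebra and absorbs even shifts of exponents.\<close>

lemma laurent_smult_monom: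
  assumes "algebra K R" "a \<in> carrier R"
  shows "monom (UP K) \<one>\<^bsub>K\<^esub> j \<odot>\<^bsub>L\<^esub> laurent_monom R a m = laurent_monom R a (m + 2 * int j)"
proof -
  interpret K: algebra K R by fact
  interpret UP: UP_cring K "UP K" by unfold_locales simp
  have c: "monom (UP K) \<one>\<^bsub>K\<^esub> j \<in> carrier (UP K)" by simp
  have "(\<lambda>n. if 0 \<le> n \<and> even n then coeff (UP K) (monom (UP K) \<one>\<^bsub>K\<^esub> j) (nat (n div 2)) \<odot>\<^bsub>R\<^esub> \<one> else \<zero>)
      = laurent_monom R \<one> (2 * int j)"
    by (auto simp: laurent_monom_def fun_eq_iff)
  then show ?thesis
    using laurent_smult_eq_mult(2)[OF assms(1) c, of "laurent_monom R a m"] assms(2)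
    by (simp add: laurent_monom_mult_monom add.commute)
qed

end

text \<open>Functoriality in the coefficients. As \<open>h\<close> preserves zero, supports can only
  shrink; products of images are therefore summed over the old support by
  \<open>laurent_mult_eq\<close>.\<close>

lemma laurent_map_hom:
  assumes "algebra K A" "algebra K B" and h: "h \<in> ring_hom A B"
    and lin: "\<And>c a. c \<in> carrier K \<Longrightarrow> a \<in> carrier A \<Longrightarrow> h (c \<odot>\<^bsub>A\<^esub> a) = c \<odot>\<^bsub>B\<^esub> h a"
  shows "(\<lambda>p n. h (p n)) \<in> ring_hom (laurent K A) (laurent K B)"
    and "\<And>c p. c \<in> carrier (UP K) \<Longrightarrow> p \<in> carrier (laurent K A) \<Longrightarrow>
      (\<lambda>n. h ((c \<odot>\<^bsub>laurent K A\<^esub> p) n)) = c \<odot>\<^bsub>laurent K B\<^esub> (\<lambda>n. h (p n))"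
    and "\<And>a m. (\<lambda>n. h (laurent_monom A a m n)) = laurent_monom B (h a) m"
proof -
  interpret A: algebra K A by fact
  interpret B: algebra K B by fact
  interpret h: ring_hom_cring A B h by unfold_locales (rule h)
  interpret LA: laurent_coefficients K A by unfold_locales
  interpret LB: laurent_coefficients K B by unfold_locales
  interpret UP: UP_cring K "UP K" by unfold_locales simp
  have closed: "(\<lambda>n. h (p n)) \<in> carrier (laurent K B)" if p: "p \<in> carrier (laurent K A)" for p
  proof -
    have "{n. h (p n) \<noteq> \<zero>\<^bsub>B\<^esub>} \<subseteq> {n. p n \<noteq> \<zero>\<^bsub>A\<^esub>}" by auto
    then show ?thesis
      using p by (auto simp: LB.laurent_carrier_iff LA.laurent_finite_support intro: finite_subset)
  qed
  show monom: "(\<lambda>n. h (laurent_monom A a m n)) = laurent_monom B (h a) m" for a m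
    by (auto simp: laurent_monom_def)
  show "(\<lambda>p n. h (p n)) \<in> ring_hom (laurent K A) (laurent K B)"
  proof (rule ring_hom_memI)
    fix p q assume pq: "p \<in> carrier (laurent K A)" "q \<in> carrier (laurent K A)"
    show "(\<lambda>n. h ((p \<oplus>\<^bsub>laurent K A\<^esub> q) n)) = (\<lambda>n. h (p n)) \<oplus>\<^bsub>laurent K B\<^esub> (\<lambda>n. h (q n))"
      using pq by (simp add: LA.laurent_add LB.laurent_add)
    show "(\<lambda>n. h ((p \<otimes>\<^bsub>laurent K A\<^esub> q) n)) = (\<lambda>n. h (p n)) \<otimes>\<^bsub>laurent K B\<^esub> (\<lambda>n. h (q n))"
    proof
      fix n
      let ?I = "{i. p i \<noteq> \<zero>\<^bsub>A\<^esub>}"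
      have "h ((p \<otimes>\<^bsub>laurent K A\<^esub> q) n) = h (\<Oplus>\<^bsub>A\<^esub>i\<in>?I. p i \<otimes>\<^bsub>A\<^esub> q (n - i))"
        by (simp add: laurent_def)
      also have "\<dots> = (\<Oplus>\<^bsub>B\<^esub>i\<in>?I. h (p i \<otimes>\<^bsub>A\<^esub> q (n - i)))"
        using pq by (subst h.hom_finsum) (auto simp: o_def)
      also have "\<dots> = (\<Oplus>\<^bsub>B\<^esub>i\<in>?I. h (p i) \<otimes>\<^bsub>B\<^esub> h (q (n - i)))"
        using pq by (intro B.M.finsum_cong') auto
      also have "\<dots> = ((\<lambda>n. h (p n)) \<otimes>\<^bsub>laurent K B\<^esub> (\<lambda>n. h (q n))) n"
        using pq by (intro LB.laurent_mult_eq[symmetric] closed) (auto simp: LA.laurent_finite_support)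
      finally show "h ((p \<otimes>\<^bsub>laurent K A\<^esub> q) n) = ((\<lambda>n. h (p n)) \<otimes>\<^bsub>laurent K B\<^esub> (\<lambda>n. h (q n))) n" .
    qed
  qed (simp_all add: closed monom LA.laurent_one LB.laurent_one)
  show "(\<lambda>n. h ((c \<odot>\<^bsub>laurent K A\<^esub> p) n)) = c \<odot>\<^bsub>laurent K B\<^esub> (\<lambda>n. h (p n))"
    if cp: "c \<in> carrier (UP K)" "p \<in> carrier (laurent K A)" for c p
  proof
    fix n
    have "h ((c \<odot>\<^bsub>laurent K A\<^esub> p) n) = h (\<Oplus>\<^bsub>A\<^esub>i\<in>{..deg K c}. coeff (UP K) c i \<odot>\<^bsub>A\<^esub> p (n - 2 * int i))"
      by (simp add: laurent_def)
    also have "\<dots> = (\<Oplus>\<^bsub>B\<^esub>i\<in>{..deg K c}. h (coeff (UP K) c i \<odot>\<^bsub>A\<^esub> p (n - 2 * int i)))"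
      using cp by (subst h.hom_finsum) (auto simp: o_def)
    also have "\<dots> = (\<Oplus>\<^bsub>B\<^esub>i\<in>{..deg K c}. coeff (UP K) c i \<odot>\<^bsub>B\<^esub> h (p (n - 2 * int i)))"
      using cp by (intro B.M.finsum_cong') (auto simp: lin)
    finally show "h ((c \<odot>\<^bsub>laurent K A\<^esub> p) n) = (c \<odot>\<^bsub>laurent K B\<^esub> (\<lambda>n. h (p n))) n"
      by (simp add: laurent_def)
  qed
qed


section \<open>Extension of the involution\<close>

locale localized_algebra =
  fixes K :: "('k, 'r) ring_scheme" and A :: "('k, 'a, 'm) module_scheme" and f :: 'a
  assumes alg: "algebra K A" and f_closed [simp, intro]: "f \<in> carrier A"
begin

abbreviation Q where "Q \<equiv> localization_at A f"
abbreviation \<iota> where "\<iota> \<equiv> to_localization_at A f"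

sublocale A: cring A by (rule algebra.M_cring[OF alg])
sublocale fraction_ring A "powers A f" by (rule fraction_ring_powers) (rule A.is_cring, simp)
sublocale Q: cring Q unfolding localization_at_def by (rule cring_localization)
sublocale A_alg: algebra K A by (rule alg)
sublocale Q_alg: algebra K Q
  unfolding localization_at_def by (rule algebra_localization) (rule alg)

lemma power_mem: "f [^]\<^bsub>A\<^esub> (n::nat) \<in> powers A f"
  by (simp add: powers_def)

lemma to_localization_hom: "\<iota> \<in> ring_hom A Q"
  unfolding localization_at_def to_localization_at_def
  by (rule ring_hom_memI) (simp_all add: S_one one_localization)

sublocale \<iota>: ring_hom_cring A Q \<iota>
  by unfold_locales (rule to_localization_hom)

lemma to_localization_smult:
  "c \<in> carrier K \<Longrightarrow> a \<in> carrier A \<Longrightarrow> \<iota> (c \<odot>\<^bsub>A\<^esub> a) = c \<odot>\<^bsub>Q\<^esub> \<iota> a"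
  unfolding localization_at_def to_localization_at_def
  by (simp add: smult_fraction[OF A_alg.scalars_multiplicative] S_one)

text \<open>Equality with the zero fraction is a statement about a multiplier in
  \<open>powers A f\<close>. This supplies the kernel condition in both uses of
  \<open>localization_algebra_iso\<close>.\<close>

lemma to_localization_eq_zero:
  assumes "a \<in> carrier A"
  shows "\<iota> a = \<zero>\<^bsub>Q\<^esub> \<longleftrightarrow> (\<exists>n::nat. f [^]\<^bsub>A\<^esub> n \<otimes>\<^bsub>A\<^esub> a = \<zero>\<^bsub>A\<^esub>)"
  using assms unfolding localization_at_def to_localization_at_def zero_localization
  by (simp add: fraction_eq_iff S_one) (auto simp: powers_def)

definition recip where "recip = fraction A (powers A f) \<one>\<^bsub>A\<^esub> f"

lemma f_mem_powers: "f \<in> powers A f"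
  using power_mem[of 1] by simp

lemma recip_closed [simp, intro]: "recip \<in> carrier Q"
  unfolding recip_def localization_at_def by (simp add: f_mem_powers)

lemma recip_mult: "recip \<otimes>\<^bsub>Q\<^esub> \<iota> f = \<one>\<^bsub>Q\<^esub>"
proof -
  have "fraction A (powers A f) f f = fraction A (powers A f) \<one>\<^bsub>A\<^esub> \<one>\<^bsub>A\<^esub>"
    by (rule fraction_eqI) (simp_all add: f_mem_powers S_one)
  then show ?thesis
    by (simp add: recip_def localization_at_def to_localization_at_def f_mem_powers S_one one_localization)
qed

lemma to_localization_f_Unit: "\<iota> f \<in> Units Q"
  unfolding Units_def using recip_mult Q.m_comm[OF recip_closed \<iota>.hom_closed[OF f_closed]]
  by (auto intro!: bexI[of _ recip])

text \<open>Clearing the denominator replaces elements of \<open>Q\<close> by images of elements of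
  \<open>A\<close>, at the price of a unit that can be cancelled later.\<close>

lemma localizationE:
  assumes "x \<in> carrier Q"
  obtains a n where "a \<in> carrier A" "x \<otimes>\<^bsub>Q\<^esub> \<iota> (f [^]\<^bsub>A\<^esub> (n::nat)) = \<iota> a"
proof -
  from assms obtain a s where a: "a \<in> carrier A" "s \<in> powers A f" "x = fraction A (powers A f) a s"
    unfolding localization_at_def by (rule fractionE)
  have "fraction A (powers A f) (a \<otimes>\<^bsub>A\<^esub> s) s = fraction A (powers A f) a \<one>\<^bsub>A\<^esub>"
    by (rule fraction_eqI) (use a S_one A.m_comm in auto)
  then have "x \<otimes>\<^bsub>Q\<^esub> \<iota> s = \<iota> a"
    using a by (simp add: localization_at_def to_localization_at_def S_one)
  then show thesis using that a by (auto simp: powers_def)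
qed

end

section \<open>The involution on the localization\<close>

locale localized_involution = localized_algebra K A f + involutive_algebra K A \<theta>
  for K :: "('k, 'r) ring_scheme" and A :: "('k, 'a, 'm) module_scheme" and f \<theta> +
  assumes \<theta>_f: "\<theta> f = f \<or> \<theta> f = \<ominus>\<^bsub>A\<^esub> f"
begin

sublocale \<theta>: ring_hom_cring A A \<theta>
  using involution_automorphism by unfold_locales (auto simp: algebra_iso_def ring_iso_def)

lemma \<theta>_smult: "c \<in> carrier K \<Longrightarrow> a \<in> carrier A \<Longrightarrow> \<theta> (c \<odot>\<^bsub>A\<^esub> a) = c \<odot>\<^bsub>A\<^esub> \<theta> a"
  using involution_automorphism by (simp add: algebra_iso_def)

lemma \<theta>_power: "\<theta> (f [^]\<^bsub>A\<^esub> (n::nat)) = f [^]\<^bsub>A\<^esub> n \<or> \<theta> (f [^]\<^bsub>A\<^esub> n) = \<ominus>\<^bsub>A\<^esub> (f [^]\<^bsub>A\<^esub> n)"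
proof (induction n)
  case (Suc n)
  then show ?case using \<theta>_f by (auto simp: A.l_minus A.r_minus)
qed simp

text \<open>The sign from \<open>\<theta>_power\<close> is squared away. So even powers are fixed in
  both cases, and multiplication by them respects both eigenspaces.\<close>

lemma \<theta>_even_power: "\<theta> (f [^]\<^bsub>A\<^esub> (n + n :: nat)) = f [^]\<^bsub>A\<^esub> (n + n)"
  using \<theta>_power[of n]
  by (auto simp: A.nat_pow_mult[symmetric] A.l_minus A.r_minus simp del: \<theta>.hom_pow)

text \<open>The recognition criterion is applied to \<open>\<iota>\<close> after
  \<open>\<theta>\<close> with target \<open>Q\<close> itself, so the extension is at once bijective
  and linear over \<open>K\<close>. That it is an involution is checked on the image of
  \<open>\<iota>\<close>.\<close>

lemma involution_extends:
  "\<exists>\<theta>'. involutive_algebra K Q \<theta>' \<and> (\<forall>a\<in>carrier A. \<theta>' (\<iota> a) = \<iota> (\<theta> a))"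
proof -
  let ?h = "\<lambda>a. \<iota> (\<theta> a)"
  have h: "?h \<in> ring_hom A Q" by (rule ring_hom_memI) simp_all
  have sign: "\<theta> s = s \<or> \<theta> s = \<ominus>\<^bsub>A\<^esub> s" if "s \<in> powers A f" for s
  proof -
    from that obtain n :: nat where "s = f [^]\<^bsub>A\<^esub> n" by (auto simp: powers_def)
    then show ?thesis using \<theta>_power[of n] by metis
  qed
  have unit: "\<iota> s \<in> Units Q" if "s \<in> powers A f" for s
  proof -
    have "\<iota> (f [^]\<^bsub>A\<^esub> n) \<in> Units Q" for n :: nat
      by (induction n) (use to_localization_f_Unit in auto)
    moreover from that obtain n :: nat where "s = f [^]\<^bsub>A\<^esub> n" by (auto simp: powers_def)
    ultimately show ?thesis by metis
  qed
  have neg_unit: "\<ominus>\<^bsub>Q\<^esub> x \<in> Units Q" if "x \<in> Units Q" for x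
  proof -
    have "\<ominus>\<^bsub>Q\<^esub> x \<otimes>\<^bsub>Q\<^esub> \<ominus>\<^bsub>Q\<^esub> (inv\<^bsub>Q\<^esub> x) = \<one>\<^bsub>Q\<^esub>" "\<ominus>\<^bsub>Q\<^esub> (inv\<^bsub>Q\<^esub> x) \<otimes>\<^bsub>Q\<^esub> \<ominus>\<^bsub>Q\<^esub> x = \<one>\<^bsub>Q\<^esub>"
      using that by (simp_all add: Q.Units_closed Q.l_minus Q.r_minus)
    then show ?thesis unfolding Units_def using that by (auto simp: Q.Units_closed)
  qed
  have h_unit: "?h s \<in> Units Q" if "s \<in> powers A f" for s
    using sign[OF that] unit[OF that] neg_unit[OF unit[OF that]] that by auto
  obtain \<phi> where iso: "\<phi> \<in> algebra_iso K (localization A (powers A f)) Q"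
    and \<phi>: "\<And>a s. a \<in> carrier A \<Longrightarrow> s \<in> powers A f \<Longrightarrow>
      \<phi> (fraction A (powers A f) a s) = ?h a \<otimes>\<^bsub>Q\<^esub> inv\<^bsub>Q\<^esub> ?h s"
  proof (rule localization_algebra_iso[OF Q.is_cring h _ _ _ A_alg.scalars_multiplicative
        Q_alg.scalars_multiplicative])
    show "?h ` powers A f \<subseteq> Units Q" using h_unit by blast
  next
    fix a assume a: "a \<in> carrier A" "?h a = \<zero>\<^bsub>Q\<^esub>"
    then obtain n :: nat where "f [^]\<^bsub>A\<^esub> n \<otimes>\<^bsub>A\<^esub> \<theta> a = \<zero>\<^bsub>A\<^esub>"
      using to_localization_eq_zero[of "\<theta> a"] by auto
    \<comment> \<open>Applying \<open>\<theta>\<close> moves the annihilation from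
      \<open>\<theta> a\<close> to \<open>a\<close>; the sign acquired by the power of
      \<open>f\<close> does not affect vanishing.\<close>
    then have "\<theta> (f [^]\<^bsub>A\<^esub> n \<otimes>\<^bsub>A\<^esub> \<theta> a) = \<zero>\<^bsub>A\<^esub>" by simp
    then have "\<theta> (f [^]\<^bsub>A\<^esub> n) \<otimes>\<^bsub>A\<^esub> a = \<zero>\<^bsub>A\<^esub>" using a by (simp add: involution_involutive del: \<theta>.hom_pow)
    then have "f [^]\<^bsub>A\<^esub> n \<otimes>\<^bsub>A\<^esub> a = \<zero>\<^bsub>A\<^esub>"
      using \<theta>_power[of n] a by (metis A.add.inv_eq_1_iff A.l_minus A.m_closed A.nat_pow_closed f_closed)
    then show "\<exists>s\<in>powers A f. s \<otimes>\<^bsub>A\<^esub> a = \<zero>\<^bsub>A\<^esub>" using power_mem by blast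
  next
    fix x assume "x \<in> carrier Q"
    then obtain a n where a: "a \<in> carrier A" "x \<otimes>\<^bsub>Q\<^esub> \<iota> (f [^]\<^bsub>A\<^esub> (n::nat)) = \<iota> a"
      by (rule localizationE)
    \<comment> \<open>The exponent is doubled so that \<open>\<theta>\<close> fixes the denominator.
      The preimage under \<open>?h\<close> is then \<open>\<theta>\<close> of the new
      numerator.\<close>
    have "x \<otimes>\<^bsub>Q\<^esub> ?h (f [^]\<^bsub>A\<^esub> (n + n)) = (x \<otimes>\<^bsub>Q\<^esub> \<iota> (f [^]\<^bsub>A\<^esub> n)) \<otimes>\<^bsub>Q\<^esub> \<iota> (f [^]\<^bsub>A\<^esub> n)"
      unfolding \<theta>_even_power unfolding A.nat_pow_mult[OF f_closed, symmetric]
      using \<open>x \<in> carrier Q\<close> by (simp add: Q.m_assoc del: \<iota>.hom_pow)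
    also have "\<dots> = ?h (\<theta> (a \<otimes>\<^bsub>A\<^esub> f [^]\<^bsub>A\<^esub> n))"
      unfolding a(2) using a(1) by (simp add: involution_involutive del: \<iota>.hom_pow \<theta>.hom_mult)
    finally show "\<exists>a\<in>carrier A. \<exists>s\<in>powers A f. x \<otimes>\<^bsub>Q\<^esub> ?h s = ?h a"
      using power_mem[of "n + n"] a(1) \<theta>.hom_closed[of "a \<otimes>\<^bsub>A\<^esub> f [^]\<^bsub>A\<^esub> n"] by blast
  next
    show "?h (c \<odot>\<^bsub>A\<^esub> a) = c \<odot>\<^bsub>Q\<^esub> ?h a" if "c \<in> carrier K" "a \<in> carrier A" for c a
      using that by (simp add: \<theta>_smult to_localization_smult)
  qed (rule that)
  have iso': "\<phi> \<in> algebra_iso K Q Q" using iso by (simp add: localization_at_def)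
  then interpret \<phi>: ring_hom_cring Q Q \<phi>
    by unfold_locales (auto simp: algebra_iso_def ring_iso_def)
  have ext: "\<phi> (\<iota> a) = \<iota> (\<theta> a)" if "a \<in> carrier A" for a
    using \<phi>[OF that S_one] that unfolding to_localization_at_def[of A f a] by simp
  have "\<phi> (\<phi> x) = x" if x: "x \<in> carrier Q" for x
  proof -
    obtain a n where a: "a \<in> carrier A" "x \<otimes>\<^bsub>Q\<^esub> \<iota> (f [^]\<^bsub>A\<^esub> (n::nat)) = \<iota> a"
      using x by (rule localizationE)
    have s: "f [^]\<^bsub>A\<^esub> n \<in> carrier A" by simp
    \<comment> \<open>The square of \<open>\<phi>\<close> is the identity on the image of
      \<open>\<iota>\<close>, in particular on this denominator and on the product with
      \<open>x\<close>; cancelling the unit leaves \<open>x\<close>.\<close>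
    have "\<phi> (\<phi> (x \<otimes>\<^bsub>Q\<^esub> \<iota> (f [^]\<^bsub>A\<^esub> n))) = \<phi> (\<phi> x) \<otimes>\<^bsub>Q\<^esub> \<phi> (\<phi> (\<iota> (f [^]\<^bsub>A\<^esub> n)))"
      using x by (simp del: \<iota>.hom_pow)
    then have "\<phi> (\<phi> x) \<otimes>\<^bsub>Q\<^esub> \<iota> (f [^]\<^bsub>A\<^esub> n) = \<phi> (\<phi> (x \<otimes>\<^bsub>Q\<^esub> \<iota> (f [^]\<^bsub>A\<^esub> n)))"
      by (simp only: ext s \<theta>.hom_closed involution_involutive)
    also have "\<dots> = x \<otimes>\<^bsub>Q\<^esub> \<iota> (f [^]\<^bsub>A\<^esub> n)"
      unfolding a(2) using a(1) by (simp add: ext involution_involutive)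
    finally show ?thesis
      using unit[OF power_mem[of n]] x
      by (metis Q.Units_closed Q.Units_l_cancel Q.m_comm \<phi>.hom_closed)
  qed
  then have "involutive_algebra K Q \<phi>"
    using iso' by unfold_locales
  then show ?thesis using ext by blast
qed

end


section \<open>Contraction algebras\<close>

lemma algebra_generated_facts:
  assumes "cring A" "scalars_multiplicative K A" "G \<subseteq> carrier A"
  shows subring_algebra_generated: "subring (algebra_generated K A G) A"
    and algebra_generated_smult:
      "\<And>c b. c \<in> carrier K \<Longrightarrow> b \<in> algebra_generated K A G \<Longrightarrow> c \<odot>\<^bsub>A\<^esub> b \<in> algebra_generated K A G"
    and algebra_generated_superset: "G \<subseteq> algebra_generated K A G"
proof -
  interpret cring A by fact
  \<comment> \<open>The whole ring belongs to the family, so the intersection is over a nonempty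
    set, as \<open>subring_Inter\<close> requires.\<close>
  have "carrier A \<in> {B. subring B A \<and> (\<forall>c\<in>carrier K. \<forall>b\<in>B. c \<odot>\<^bsub>A\<^esub> b \<in> B) \<and> G \<subseteq> B}"
    using assms(3) scalars_multiplicativeD(1)[OF assms(2)] carrier_is_subring by blast
  then show "subring (algebra_generated K A G) A"
    unfolding algebra_generated_def by (intro subring_Inter) auto
qed (auto simp: algebra_generated_def)

lemma algebra_generated_least:
  assumes "subring B A" "\<And>c b. c \<in> carrier K \<Longrightarrow> b \<in> B \<Longrightarrow> c \<odot>\<^bsub>A\<^esub> b \<in> B" "G \<subseteq> B"
  shows "algebra_generated K A G \<subseteq> B"
  using assms unfolding algebra_generated_def by blast

lemma cring_subring:
  assumes "cring A" "subring B A"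
  shows "cring (A\<lparr>carrier := B\<rparr>)"
proof -
  interpret cring A by fact
  show ?thesis using subcring_iff[OF subringE(1)[OF assms(2)]] subcringI'[OF assms(2)] by simp
qed

context
  fixes K :: "('k, 'r) ring_scheme" and A :: "('k, 'a, 'm) module_scheme" and \<theta>
  assumes inv: "involutive_algebra K A \<theta>"
begin

interpretation involutive_algebra K A \<theta> by (rule inv)
interpretation laurent_coefficients K A by unfold_locales
interpretation L: cring "laurent K A" by (rule cring_laurent)

lemma contraction_algebra_ops [simp]:
  "mult (contraction_algebra K A \<theta>) = mult (laurent K A)"
  "one (contraction_algebra K A \<theta>) = one (laurent K A)"
  "zero (contraction_algebra K A \<theta>) = zero (laurent K A)"
  "add (contraction_algebra K A \<theta>) = add (laurent K A)"
  "smult (contraction_algebra K A \<theta>) = smult (laurent K A)"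
  by (simp_all add: contraction_algebra_def)

lemma contraction_algebra_eq:
  "contraction_algebra K A \<theta> = (laurent K A)\<lparr>carrier := carrier (contraction_algebra K A \<theta>)\<rparr>"
  by (simp add: contraction_algebra_def)

private lemma generators_closed:
  "(\<lambda>a. laurent_monom A a 0) ` fixed_part A \<theta> \<union>
   (\<lambda>a. laurent_monom A a (- 1)) ` antifixed_part A \<theta> \<subseteq> carrier (laurent K A)"
  by (auto simp: fixed_part_def antifixed_part_def)

private lemmas generated = L.is_cring scalars_multiplicative_laurent[OF algebra_axioms] generators_closed

lemma subring_contraction: "subring (carrier (contraction_algebra K A \<theta>)) (laurent K A)"
  using subring_algebra_generated[OF generated] by (simp add: contraction_algebra_def)

lemma contraction_smult_closed:
  "c \<in> carrier (UP K) \<Longrightarrow> p \<in> carrier (contraction_algebra K A \<theta>) \<Longrightarrow>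
    c \<odot>\<^bsub>laurent K A\<^esub> p \<in> carrier (contraction_algebra K A \<theta>)"
  using algebra_generated_smult[OF generated] by (simp add: contraction_algebra_def)

lemma contraction_fixed:
    "a \<in> fixed_part A \<theta> \<Longrightarrow> laurent_monom A a 0 \<in> carrier (contraction_algebra K A \<theta>)"
  and contraction_antifixed:
    "a \<in> antifixed_part A \<theta> \<Longrightarrow> laurent_monom A a (- 1) \<in> carrier (contraction_algebra K A \<theta>)"
  using algebra_generated_superset[OF generated] by (auto simp: contraction_algebra_def)

text \<open>Serves as an induction principle: a property holds on the contraction algebra if the
  elements having it form a subring closed under polynomial scalars and containing both kinds of
  generators.\<close>

lemma contraction_least:
  assumes "subring B (laurent K A)"
    and "\<And>c b. c \<in> carrier (UP K) \<Longrightarrow> b \<in> B \<Longrightarrow> c \<odot>\<^bsub>laurent K A\<^esub> b \<in> B"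
    and "\<And>a. a \<in> fixed_part A \<theta> \<Longrightarrow> laurent_monom A a 0 \<in> B"
    and "\<And>a. a \<in> antifixed_part A \<theta> \<Longrightarrow> laurent_monom A a (- 1) \<in> B"
  shows "carrier (contraction_algebra K A \<theta>) \<subseteq> B"
  unfolding contraction_algebra_def using assms by (simp add: algebra_generated_least image_subset_iff)

lemma contraction_subset: "carrier (contraction_algebra K A \<theta>) \<subseteq> carrier (laurent K A)"
  by (rule subringE(1)[OF subring_contraction])

lemma cring_contraction: "cring (contraction_algebra K A \<theta>)"
  using cring_subring[OF L.is_cring subring_contraction] contraction_algebra_eq by simp

lemma contraction_pow: "p [^]\<^bsub>contraction_algebra K A \<theta>\<^esub> (n::nat) = p [^]\<^bsub>laurent K A\<^esub> n"
  by (simp add: nat_pow_def)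

lemma scalars_multiplicative_contraction: "scalars_multiplicative (UP K) (contraction_algebra K A \<theta>)"
  unfolding scalars_multiplicative_def
  using contraction_smult_closed contraction_subset
    scalars_multiplicativeD(2)[OF scalars_multiplicative_laurent[OF algebra_axioms]]
  by (simp add: subset_iff)

end

section \<open>Comparison of the two contraction algebras\<close>

context localized_involution
begin

text \<open>\<open>\<theta>' recip\<close> is an inverse of \<open>\<iota> (\<theta> f)\<close>, so
  uniqueness of inverses transfers the sign of \<open>f\<close> to its reciprocal.\<close>

lemma involution_recip:
  assumes extends: "involutive_algebra K Q \<theta>'" "\<And>a. a \<in> carrier A \<Longrightarrow> \<theta>' (\<iota> a) = \<iota> (\<theta> a)"
  shows "\<theta> f = f \<Longrightarrow> recip \<in> fixed_part Q \<theta>'"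
    and "\<theta> f = \<ominus>\<^bsub>A\<^esub> f \<Longrightarrow> recip \<in> antifixed_part Q \<theta>'"
proof -
  interpret \<theta>': involutive_algebra K Q \<theta>' by (rule extends)
  interpret \<theta>': ring_hom_cring Q Q \<theta>'
    using \<theta>'.involution_automorphism by unfold_locales (auto simp: algebra_iso_def ring_iso_def)
  have "\<theta>' (recip \<otimes>\<^bsub>Q\<^esub> \<iota> f) = \<one>\<^bsub>Q\<^esub>" by (simp add: recip_mult del: \<theta>'.hom_mult)
  then have 1: "\<theta>' recip \<otimes>\<^bsub>Q\<^esub> \<iota> (\<theta> f) = \<one>\<^bsub>Q\<^esub>" by (simp add: extends(2))
  have unique: "x = recip" if x: "x \<in> carrier Q" "x \<otimes>\<^bsub>Q\<^esub> \<iota> f = \<one>\<^bsub>Q\<^esub>" for x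
    using Q.inv_unique[of x "\<iota> f" recip] x recip_mult Q.m_comm[of recip "\<iota> f"] by simp
  show "recip \<in> fixed_part Q \<theta>'" if "\<theta> f = f"
    using unique[of "\<theta>' recip"] 1 that by (simp add: fixed_part_def)
  show "recip \<in> antifixed_part Q \<theta>'" if "\<theta> f = \<ominus>\<^bsub>A\<^esub> f"
  proof -
    have "\<ominus>\<^bsub>Q\<^esub> \<theta>' recip = recip"
      by (rule unique) (use 1 that in \<open>simp_all add: Q.l_minus Q.r_minus\<close>)
    then show ?thesis unfolding antifixed_part_def using Q.minus_minus[of "\<theta>' recip"] by auto
  qed
qed

text \<open>The denominators are even powers for two reasons: they are fixed by
  \<open>\<theta>\<close> in both cases, and the exponent shift they later cause is a power of
  t.\<close>

lemma eigenvector_clear_denominator: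
  assumes extends: "involutive_algebra K Q \<theta>'" "\<And>a. a \<in> carrier A \<Longrightarrow> \<theta>' (\<iota> a) = \<iota> (\<theta> a)"
    and two: "\<one>\<^bsub>K\<^esub> \<oplus>\<^bsub>K\<^esub> \<one>\<^bsub>K\<^esub> \<in> Units K"
  shows "x \<in> fixed_part Q \<theta>' \<Longrightarrow> \<exists>y\<in>fixed_part A \<theta>. \<exists>n::nat. x \<otimes>\<^bsub>Q\<^esub> \<iota> (f [^]\<^bsub>A\<^esub> (n + n)) = \<iota> y"
    and "x \<in> antifixed_part Q \<theta>' \<Longrightarrow> \<exists>y\<in>antifixed_part A \<theta>. \<exists>n::nat. x \<otimes>\<^bsub>Q\<^esub> \<iota> (f [^]\<^bsub>A\<^esub> (n + n)) = \<iota> y"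
proof -
  interpret \<theta>': involutive_algebra K Q \<theta>' by (rule extends)
  interpret \<theta>': ring_hom_cring Q Q \<theta>'
    using \<theta>'.involution_automorphism by unfold_locales (auto simp: algebra_iso_def ring_iso_def)
  define half where "half = inv\<^bsub>K\<^esub> (\<one>\<^bsub>K\<^esub> \<oplus>\<^bsub>K\<^esub> \<one>\<^bsub>K\<^esub>)"
  have half: "half \<in> carrier K" "half \<oplus>\<^bsub>K\<^esub> half = \<one>\<^bsub>K\<^esub>"
  proof -
    show h: "half \<in> carrier K" unfolding half_def using two by simp
    have "half \<otimes>\<^bsub>K\<^esub> (\<one>\<^bsub>K\<^esub> \<oplus>\<^bsub>K\<^esub> \<one>\<^bsub>K\<^esub>) = \<one>\<^bsub>K\<^esub>" unfolding half_def using two by simp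
    then show "half \<oplus>\<^bsub>K\<^esub> half = \<one>\<^bsub>K\<^esub>" using h by (simp add: A_alg.R.r_distr)
  qed
  have half_twice: "half \<odot>\<^bsub>Q\<^esub> (z \<oplus>\<^bsub>Q\<^esub> z) = z" if "z \<in> carrier Q" for z
    using that half by (simp add: Q_alg.smult_r_distr Q_alg.smult_l_distr[symmetric])
  \<comment> \<open>One even power clears \<open>x\<close> and \<open>\<theta>' x\<close>
    simultaneously, with conjugate numerators: apply \<open>\<theta>'\<close> to the equation for
    \<open>x\<close>.\<close>
  have clear: "\<exists>a\<in>carrier A. \<exists>n::nat. x \<otimes>\<^bsub>Q\<^esub> \<iota> (f [^]\<^bsub>A\<^esub> (n + n)) = \<iota> a \<and>
      \<theta>' x \<otimes>\<^bsub>Q\<^esub> \<iota> (f [^]\<^bsub>A\<^esub> (n + n)) = \<iota> (\<theta> a)" if x: "x \<in> carrier Q" for x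
  proof -
    obtain a n where a: "a \<in> carrier A" "x \<otimes>\<^bsub>Q\<^esub> \<iota> (f [^]\<^bsub>A\<^esub> (n::nat)) = \<iota> a"
      using x by (rule localizationE)
    have "x \<otimes>\<^bsub>Q\<^esub> \<iota> (f [^]\<^bsub>A\<^esub> (n + n)) = (x \<otimes>\<^bsub>Q\<^esub> \<iota> (f [^]\<^bsub>A\<^esub> n)) \<otimes>\<^bsub>Q\<^esub> \<iota> (f [^]\<^bsub>A\<^esub> n)"
      unfolding A.nat_pow_mult[OF f_closed, symmetric] using x by (simp add: Q.m_assoc del: \<iota>.hom_pow)
    also have "\<dots> = \<iota> (a \<otimes>\<^bsub>A\<^esub> f [^]\<^bsub>A\<^esub> n)" using a by (simp del: \<iota>.hom_pow)
    finally have 1: "x \<otimes>\<^bsub>Q\<^esub> \<iota> (f [^]\<^bsub>A\<^esub> (n + n)) = \<iota> (a \<otimes>\<^bsub>A\<^esub> f [^]\<^bsub>A\<^esub> n)" .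
    have "\<theta>' (x \<otimes>\<^bsub>Q\<^esub> \<iota> (f [^]\<^bsub>A\<^esub> (n + n))) = \<theta>' x \<otimes>\<^bsub>Q\<^esub> \<iota> (\<theta> (f [^]\<^bsub>A\<^esub> (n + n)))"
      using x by (simp add: extends(2) del: \<iota>.hom_pow \<theta>.hom_pow)
    then have "\<theta>' x \<otimes>\<^bsub>Q\<^esub> \<iota> (f [^]\<^bsub>A\<^esub> (n + n)) = \<iota> (\<theta> (a \<otimes>\<^bsub>A\<^esub> f [^]\<^bsub>A\<^esub> n))"
      unfolding 1 \<theta>_even_power using a by (simp add: extends(2) del: \<iota>.hom_mult \<theta>.hom_mult)
    with 1 a(1) show ?thesis by (intro bexI[of _ "a \<otimes>\<^bsub>A\<^esub> f [^]\<^bsub>A\<^esub> n"] exI[of _ n]) auto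
  qed
  show "\<exists>y\<in>fixed_part A \<theta>. \<exists>n::nat. x \<otimes>\<^bsub>Q\<^esub> \<iota> (f [^]\<^bsub>A\<^esub> (n + n)) = \<iota> y" if x: "x \<in> fixed_part Q \<theta>'"
  proof -
    obtain a and n :: nat where a: "a \<in> carrier A" "x \<otimes>\<^bsub>Q\<^esub> \<iota> (f [^]\<^bsub>A\<^esub> (n + n)) = \<iota> a"
      "x \<otimes>\<^bsub>Q\<^esub> \<iota> (f [^]\<^bsub>A\<^esub> (n + n)) = \<iota> (\<theta> a)"
      using clear[of x] x by (auto simp: fixed_part_def)
    \<comment> \<open>The numerator \<open>a\<close> agrees with \<open>\<theta> a\<close> only
      after applying \<open>\<iota>\<close>. The average is fixed already in \<open>A\<close> and
      has the same image.\<close>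
    let ?y = "half \<odot>\<^bsub>A\<^esub> (a \<oplus>\<^bsub>A\<^esub> \<theta> a)"
    have "?y \<in> fixed_part A \<theta>"
      using a(1) half by (simp add: fixed_part_def \<theta>_smult involution_involutive A.a_comm)
    moreover have "\<iota> ?y = \<iota> a"
      using a half half_twice[of "\<iota> a"] by (simp add: to_localization_smult)
    ultimately show ?thesis using a(2) by metis
  qed
  show "\<exists>y\<in>antifixed_part A \<theta>. \<exists>n::nat. x \<otimes>\<^bsub>Q\<^esub> \<iota> (f [^]\<^bsub>A\<^esub> (n + n)) = \<iota> y" if x: "x \<in> antifixed_part Q \<theta>'"
  proof -
    obtain a and n :: nat where a: "a \<in> carrier A" "x \<otimes>\<^bsub>Q\<^esub> \<iota> (f [^]\<^bsub>A\<^esub> (n + n)) = \<iota> a"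
      "\<theta>' x \<otimes>\<^bsub>Q\<^esub> \<iota> (f [^]\<^bsub>A\<^esub> (n + n)) = \<iota> (\<theta> a)"
      using clear[of x] x by (auto simp: antifixed_part_def)
    have "\<iota> (\<theta> a) = \<ominus>\<^bsub>Q\<^esub> \<iota> a"
      unfolding a(2,3)[symmetric] using x by (simp add: antifixed_part_def Q.l_minus)
    \<comment> \<open>The projection to the other eigenspace; its image is that of \<open>a\<close>
      because \<open>\<iota> (\<theta> a)\<close> is the negative of
      \<open>\<iota> a\<close>.\<close>
    let ?y = "half \<odot>\<^bsub>A\<^esub> (a \<ominus>\<^bsub>A\<^esub> \<theta> a)"
    have "?y \<in> antifixed_part A \<theta>"
      using a(1) half by (simp add: antifixed_part_def \<theta>_smult involution_involutive A.minus_eq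
        A.a_comm A.minus_add A_alg.smult_r_minus[symmetric])
    moreover have "\<iota> ?y = \<iota> a"
      using a(1) half half_twice[of "\<iota> a"] \<open>\<iota> (\<theta> a) = \<ominus>\<^bsub>Q\<^esub> \<iota> a\<close>
      by (simp add: to_localization_smult A.minus_eq)
    ultimately show ?thesis using a(2) by metis
  qed
qed

text \<open>The inverted element is \<open>F = f (\<surd>t)\<^sup>e\<close>, so that both cases are treated at once.\<close>
lemma contraction_localization:
  fixes e :: nat
  assumes extends: "involutive_algebra K Q \<theta>'" "\<And>a. a \<in> carrier A \<Longrightarrow> \<theta>' (\<iota> a) = \<iota> (\<theta> a)"
    and two: "\<one>\<^bsub>K\<^esub> \<oplus>\<^bsub>K\<^esub> \<one>\<^bsub>K\<^esub> \<in> Units K"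
    and e: "e = 0 \<and> \<theta> f = f \<or> e = 1 \<and> \<theta> f = \<ominus>\<^bsub>A\<^esub> f"
  shows "algebra_isomorphic (UP K) (contraction_algebra K Q \<theta>')
    (localization_at (contraction_algebra K A \<theta>) (laurent_monom A f (int e)))"
proof -
  interpret \<theta>': involutive_algebra K Q \<theta>' by (rule extends)
  interpret \<theta>': ring_hom_cring Q Q \<theta>'
    using \<theta>'.involution_automorphism by unfold_locales (auto simp: algebra_iso_def ring_iso_def)
  interpret LA: laurent_coefficients K A by unfold_locales
  interpret LQ: laurent_coefficients K Q by unfold_locales
  interpret RA: cring "laurent K A" by (rule LA.cring_laurent)
  interpret RQ: cring "laurent K Q" by (rule LQ.cring_laurent)
  interpret UP: UP_cring K "UP K" by unfold_locales simp
  let ?B = "contraction_algebra K A \<theta>" and ?C = "contraction_algebra K Q \<theta>'"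
  \<comment> \<open>\<open>?G\<close> is to become the inverse of the image of \<open>?F\<close>.
    Its exponent 0 or -1 is that of a generator from a fixed or antifixed element.\<close>
  let ?F = "laurent_monom A f (int e)" and ?G = "laurent_monom Q recip (- int e)"
  let ?t = "\<lambda>j. monom (UP K) \<one>\<^bsub>K\<^esub> j"
  note inv = involutive_algebra_axioms
  note ops = contraction_algebra_ops[OF inv] contraction_algebra_ops[OF extends(1)]
  note BL = contraction_subset[OF inv, THEN subsetD]
    and CL = contraction_subset[OF extends(1), THEN subsetD]
  note B = subringE[OF subring_contraction[OF inv]]
    and C = subringE[OF subring_contraction[OF extends(1)]]
  interpret B: cring ?B by (rule cring_contraction[OF inv])
  interpret C: cring ?C by (rule cring_contraction[OF extends(1)])
  define \<psi> where "\<psi> = (\<lambda>(p :: int \<Rightarrow> 'a) n. \<iota> (p n))"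
  note map = laurent_map_hom[OF alg Q_alg.algebra_axioms to_localization_hom]
  have \<psi>_hom: "\<psi> \<in> ring_hom (laurent K A) (laurent K Q)"
    unfolding \<psi>_def by (rule map(1)) (rule to_localization_smult)
  interpret \<psi>: ring_hom_cring "laurent K A" "laurent K Q" \<psi>
    by unfold_locales (rule \<psi>_hom)
  have \<psi>_smult: "\<psi> (c \<odot>\<^bsub>laurent K A\<^esub> p) = c \<odot>\<^bsub>laurent K Q\<^esub> \<psi> p"
    if "c \<in> carrier (UP K)" "p \<in> carrier (laurent K A)" for c p
    unfolding \<psi>_def by (rule map(2)[OF _ that]) (rule to_localization_smult)
  have \<psi>_monom: "\<psi> (laurent_monom A a m) = laurent_monom Q (\<iota> a) m" for a m
    unfolding \<psi>_def by (rule map(3)) (rule to_localization_smult)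
  have \<psi>_closed: "\<psi> p \<in> carrier ?C" if "p \<in> carrier ?B" for p
  proof -
    \<comment> \<open>The preimage of the target contraction algebra is a subalgebra containing the
      generators, because \<open>\<iota>\<close> intertwines the two involutions.\<close>
    let ?D = "{p \<in> carrier (laurent K A). \<psi> p \<in> carrier ?C}"
    have "carrier ?B \<subseteq> ?D"
    proof (rule contraction_least[OF inv])
      show "subring ?D (laurent K A)"
        by (rule RA.subringI) (use C in auto)
      show "c \<odot>\<^bsub>laurent K A\<^esub> p \<in> ?D" if "c \<in> carrier (UP K)" "p \<in> ?D" for c p
        using that contraction_smult_closed[OF extends(1)] \<psi>_smult
          scalars_multiplicativeD(1)[OF LA.scalars_multiplicative_laurent[OF alg]] by auto
      show "laurent_monom A a 0 \<in> ?D" if "a \<in> fixed_part A \<theta>" for a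
        using that contraction_fixed[OF extends(1), of "\<iota> a"]
        by (auto simp: fixed_part_def \<psi>_monom extends(2))
      show "laurent_monom A a (- 1) \<in> ?D" if "a \<in> antifixed_part A \<theta>" for a
        using that contraction_antifixed[OF extends(1), of "\<iota> a"]
        by (auto simp: antifixed_part_def \<psi>_monom extends(2))
    qed
    with that show ?thesis by blast
  qed
  have t_closed: "?t j \<in> carrier (UP K)" for j by simp
  have F: "?F \<in> carrier ?B"
  proof (cases "e = 0")
    case True
    then show ?thesis using e contraction_fixed[OF inv, of f] by (simp add: fixed_part_def)
  next
    case False
    then have "laurent_monom A f (- 1) \<in> carrier ?B"
      using e contraction_antifixed[OF inv, of f] by (simp add: antifixed_part_def)
    \<comment> \<open>Multiplying the generator of exponent -1 by t raises the exponent to 1, which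
      gives the odd element F.\<close>
    then have "?t 1 \<odot>\<^bsub>laurent K A\<^esub> laurent_monom A f (- 1) \<in> carrier ?B"
      by (rule contraction_smult_closed[OF inv t_closed])
    then show ?thesis using False e LA.laurent_smult_monom[OF alg f_closed, of 1 "- 1"] by simp
  qed
  have G: "?G \<in> carrier ?C"
    using e involution_recip[OF extends] contraction_fixed[OF extends(1)]
      contraction_antifixed[OF extends(1)] by auto
  have F_pow: "?F [^]\<^bsub>?B\<^esub> n = laurent_monom A (f [^]\<^bsub>A\<^esub> n) (int n * int e)" for n :: nat
    unfolding contraction_pow[OF inv] by (rule LA.laurent_monom_pow) simp
  interpret S: fraction_ring ?B "powers ?B ?F"
    by (rule fraction_ring_powers[OF B.is_cring F])
  have hom: "\<psi> \<in> ring_hom ?B ?C"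
    by (rule ring_hom_memI) (auto simp: ops \<psi>_closed BL)
  interpret \<psi>': ring_hom_cring ?B ?C \<psi> by unfold_locales (rule hom)
  have GF: "?G \<otimes>\<^bsub>?C\<^esub> \<psi> ?F = \<one>\<^bsub>?C\<^esub>"
    by (simp add: ops \<psi>_monom LQ.laurent_monom_mult_monom recip_mult LQ.laurent_one)
  then have "\<psi> ?F \<otimes>\<^bsub>?C\<^esub> ?G = \<one>\<^bsub>?C\<^esub>"
    using C.m_comm[OF G \<psi>_closed[OF F]] by simp
  with GF have F_unit: "\<psi> ?F \<in> Units ?C"
    unfolding Units_def using G \<psi>_closed[OF F] by blast
  obtain \<phi> where "\<phi> \<in> algebra_iso (UP K) (localization ?B (powers ?B ?F)) ?C"
  proof (rule S.localization_algebra_iso[OF C.is_cring hom _ _ _ scalars_multiplicative_contraction[OF inv]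
        scalars_multiplicative_contraction[OF extends(1)]])
    have "\<psi> (?F [^]\<^bsub>?B\<^esub> n) \<in> Units ?C" for n :: nat
    proof -
      have "\<psi> ?F [^]\<^bsub>?C\<^esub> n \<in> Units ?C" by (induction n) (use F_unit in auto)
      then show ?thesis using \<psi>'.hom_pow[OF F] by simp
    qed
    then show "\<psi> ` powers ?B ?F \<subseteq> Units ?C" unfolding powers_def by blast
  next
    fix p assume p: "p \<in> carrier ?B" "\<psi> p = \<zero>\<^bsub>?C\<^esub>"
    have pL: "p \<in> carrier (laurent K A)" using p(1) by (rule BL)
    let ?S = "{n. p n \<noteq> \<zero>\<^bsub>A\<^esub>}"
    have "\<iota> (p n) = \<zero>\<^bsub>Q\<^esub>" for n
      using fun_cong[OF p(2), of n] by (simp add: ops LQ.laurent_zero \<psi>_def)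
    then have "\<exists>k::nat. f [^]\<^bsub>A\<^esub> k \<otimes>\<^bsub>A\<^esub> p n = \<zero>\<^bsub>A\<^esub>" for n
      using to_localization_eq_zero[of "p n"] pL by auto
    then obtain k :: "int \<Rightarrow> nat" where k: "\<And>n. f [^]\<^bsub>A\<^esub> k n \<otimes>\<^bsub>A\<^esub> p n = \<zero>\<^bsub>A\<^esub>" by metis
    \<comment> \<open>Finite support allows one power of \<open>f\<close> to annihilate all
      coefficients at once; inserting 0 keeps the maximum meaningful when \<open>p\<close> is
      zero.\<close>
    define N where "N = Max (insert 0 (k ` ?S))"
    have fin: "finite ?S" by (rule LA.laurent_finite_support[OF pL])
    have zero: "f [^]\<^bsub>A\<^esub> N \<otimes>\<^bsub>A\<^esub> p n = \<zero>\<^bsub>A\<^esub>" for n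
    proof (cases "n \<in> ?S")
      case True
      then have "k n \<le> N" unfolding N_def using fin by (intro Max_ge) auto
      then have "f [^]\<^bsub>A\<^esub> N = f [^]\<^bsub>A\<^esub> (N - k n) \<otimes>\<^bsub>A\<^esub> f [^]\<^bsub>A\<^esub> k n"
        by (simp add: A.nat_pow_mult)
      then show ?thesis using k[of n] pL by (simp add: A.m_assoc)
    qed simp
    have "?F [^]\<^bsub>?B\<^esub> N \<otimes>\<^bsub>?B\<^esub> p = \<zero>\<^bsub>?B\<^esub>"
      unfolding F_pow ops using pL zero
      by (intro ext) (simp add: LA.laurent_monom_mult LA.laurent_zero)
    then show "\<exists>s\<in>powers ?B ?F. s \<otimes>\<^bsub>?B\<^esub> p = \<zero>\<^bsub>?B\<^esub>" unfolding powers_def by blast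
  next
    fix y assume y: "y \<in> carrier ?C"
    \<comment> \<open>The elements whose denominator can be cleared. Showing that they form a
      subalgebra reduces surjectivity to the generators.\<close>
    let ?D = "{y \<in> carrier ?C. \<exists>p\<in>carrier ?B. \<exists>s\<in>powers ?B ?F. y \<otimes>\<^bsub>?C\<^esub> \<psi> s = \<psi> p}"
    have D_subset: "carrier ?C \<subseteq> ?D"
    proof (rule contraction_least[OF extends(1)])
      show "subring ?D (laurent K Q)"
      proof (rule RQ.subringI)
        show "?D \<subseteq> carrier (laurent K Q)" using CL by blast
        have "\<one>\<^bsub>laurent K Q\<^esub> \<otimes>\<^bsub>laurent K Q\<^esub> \<psi> \<one>\<^bsub>laurent K A\<^esub> = \<psi> \<one>\<^bsub>laurent K A\<^esub>" by simp
        then show "\<one>\<^bsub>laurent K Q\<^esub> \<in> ?D"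
          using S.S_one C(3) B(3) unfolding mem_Collect_eq ops by blast
      next
        fix y assume "y \<in> ?D"
        then obtain p s where p: "y \<in> carrier ?C" "p \<in> carrier ?B" "s \<in> powers ?B ?F"
          "y \<otimes>\<^bsub>laurent K Q\<^esub> \<psi> s = \<psi> p" by (auto simp: ops)
        then have "(\<ominus>\<^bsub>laurent K Q\<^esub> y) \<otimes>\<^bsub>laurent K Q\<^esub> \<psi> s = \<psi> (\<ominus>\<^bsub>laurent K A\<^esub> p)"
          by (simp add: RQ.l_minus BL CL S.S_carrier)
        with p show "\<ominus>\<^bsub>laurent K Q\<^esub> y \<in> ?D" using B(5) C(5) by (auto simp: ops)
      next
        fix y z assume "y \<in> ?D" "z \<in> ?D"
        then obtain p s q u where y: "y \<in> carrier ?C" "p \<in> carrier ?B" "s \<in> powers ?B ?F"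
          "y \<otimes>\<^bsub>laurent K Q\<^esub> \<psi> s = \<psi> p"
          and z: "z \<in> carrier ?C" "q \<in> carrier ?B" "u \<in> powers ?B ?F"
          "z \<otimes>\<^bsub>laurent K Q\<^esub> \<psi> u = \<psi> q" by (auto simp: ops)
        have su: "s \<in> carrier ?B" "u \<in> carrier ?B" "s \<otimes>\<^bsub>laurent K A\<^esub> u \<in> powers ?B ?F"
          using y(3) z(3) S.S_mult[OF y(3) z(3)] S.S_carrier by (simp_all add: ops)
        note c = y(1,2) z(1,2) su(1,2) BL CL \<psi>.hom_closed
        have "(y \<otimes>\<^bsub>laurent K Q\<^esub> z) \<otimes>\<^bsub>laurent K Q\<^esub> \<psi> (s \<otimes>\<^bsub>laurent K A\<^esub> u) =
            (y \<otimes>\<^bsub>laurent K Q\<^esub> \<psi> s) \<otimes>\<^bsub>laurent K Q\<^esub> (z \<otimes>\<^bsub>laurent K Q\<^esub> \<psi> u)"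
          using c by (simp add: RQ.m_ac)
        also have "\<dots> = \<psi> (p \<otimes>\<^bsub>laurent K A\<^esub> q)"
          unfolding y(4) z(4) using c by simp
        finally show "y \<otimes>\<^bsub>laurent K Q\<^esub> z \<in> ?D"
          using su(3) B(6)[OF y(2) z(2)] C(6)[OF y(1) z(1)] by (auto simp: ops)
        \<comment> \<open>Addition over the common denominator: the numerators are multiplied
          crosswise and stay in \<open>?B\<close>.\<close>
        have "(y \<oplus>\<^bsub>laurent K Q\<^esub> z) \<otimes>\<^bsub>laurent K Q\<^esub> \<psi> (s \<otimes>\<^bsub>laurent K A\<^esub> u) =
            (y \<otimes>\<^bsub>laurent K Q\<^esub> \<psi> s) \<otimes>\<^bsub>laurent K Q\<^esub> \<psi> u \<oplus>\<^bsub>laurent K Q\<^esub>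
            (z \<otimes>\<^bsub>laurent K Q\<^esub> \<psi> u) \<otimes>\<^bsub>laurent K Q\<^esub> \<psi> s"
          using c by (simp add: RQ.m_ac RQ.r_distr)
        also have "\<dots> = \<psi> (p \<otimes>\<^bsub>laurent K A\<^esub> u \<oplus>\<^bsub>laurent K A\<^esub> q \<otimes>\<^bsub>laurent K A\<^esub> s)"
          unfolding y(4) z(4) using c by simp
        finally show "y \<oplus>\<^bsub>laurent K Q\<^esub> z \<in> ?D"
          using su(3) B(7)[OF B(6)[OF y(2) su(2)] B(6)[OF z(2) su(1)]] C(7)[OF y(1) z(1)]
          by (auto simp: ops)
      qed
      show "c \<odot>\<^bsub>laurent K Q\<^esub> y \<in> ?D" if "c \<in> carrier (UP K)" "y \<in> ?D" for c y
      proof -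
        obtain p s where p: "y \<in> carrier ?C" "p \<in> carrier ?B" "s \<in> powers ?B ?F"
          "y \<otimes>\<^bsub>laurent K Q\<^esub> \<psi> s = \<psi> p" using \<open>y \<in> ?D\<close> by (auto simp: ops)
        have "(c \<odot>\<^bsub>laurent K Q\<^esub> y) \<otimes>\<^bsub>laurent K Q\<^esub> \<psi> s = c \<odot>\<^bsub>laurent K Q\<^esub> (y \<otimes>\<^bsub>laurent K Q\<^esub> \<psi> s)"
          using p S.S_carrier[OF p(3)] that(1)
          by (intro scalars_multiplicativeD(2)[OF LQ.scalars_multiplicative_laurent[OF Q_alg.algebra_axioms]])
            (simp_all add: BL CL)
        also have "\<dots> = \<psi> (c \<odot>\<^bsub>laurent K A\<^esub> p)"
          unfolding p(4) using that(1) p(2) by (simp add: \<psi>_smult BL)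
        finally show ?thesis
          using p that(1) contraction_smult_closed[OF inv] contraction_smult_closed[OF extends(1)]
          by (auto simp: ops)
      qed
      have clear: "laurent_monom Q a m \<in> ?D"
        if a: "a \<in> carrier Q" "laurent_monom Q a m \<in> carrier ?C"
          and y: "y \<in> carrier A" "laurent_monom A y m \<in> carrier ?B"
          and eq: "a \<otimes>\<^bsub>Q\<^esub> \<iota> (f [^]\<^bsub>A\<^esub> (n + n)) = \<iota> y" for a y m and n :: nat
      proof -
        \<comment> \<open>Multiplication by the power of \<open>?F\<close> raises the exponent by
          \<open>2 * n * e\<close>. This even shift equals the action of a power of t, under which
          \<open>?B\<close> is closed.\<close>
        have "laurent_monom Q a m \<otimes>\<^bsub>laurent K Q\<^esub> \<psi> (?F [^]\<^bsub>?B\<^esub> (n + n)) =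
            laurent_monom Q (\<iota> y) (m + 2 * int (n * e))"
          unfolding F_pow \<psi>_monom eq[symmetric] using a
          by (simp add: LQ.laurent_monom_mult_monom algebra_simps del: \<iota>.hom_pow)
        also have "\<dots> = \<psi> (?t (n * e) \<odot>\<^bsub>laurent K A\<^esub> laurent_monom A y m)"
          using y by (simp add: LA.laurent_smult_monom[OF alg] \<psi>_monom)
        finally have "laurent_monom Q a m \<otimes>\<^bsub>laurent K Q\<^esub> \<psi> (?F [^]\<^bsub>?B\<^esub> (n + n)) =
            \<psi> (?t (n * e) \<odot>\<^bsub>laurent K A\<^esub> laurent_monom A y m)" .
        moreover have "?F [^]\<^bsub>?B\<^esub> (n + n) \<in> powers ?B ?F" unfolding powers_def by blast
        ultimately show ?thesis
          using a(2) contraction_smult_closed[OF inv t_closed y(2)] unfolding mem_Collect_eq ops by blast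
      qed
      show "laurent_monom Q a 0 \<in> ?D" if "a \<in> fixed_part Q \<theta>'" for a
      proof -
        obtain y and n :: nat where "y \<in> fixed_part A \<theta>" "a \<otimes>\<^bsub>Q\<^esub> \<iota> (f [^]\<^bsub>A\<^esub> (n + n)) = \<iota> y"
          using eigenvector_clear_denominator(1)[OF extends two \<open>a \<in> fixed_part Q \<theta>'\<close>] by blast
        then show ?thesis
          using that contraction_fixed[OF inv] contraction_fixed[OF extends(1)]
          by (intro clear[of a 0 y n]) (auto simp: fixed_part_def)
      qed
      show "laurent_monom Q a (- 1) \<in> ?D" if "a \<in> antifixed_part Q \<theta>'" for a
      proof -
        obtain y and n :: nat where "y \<in> antifixed_part A \<theta>" "a \<otimes>\<^bsub>Q\<^esub> \<iota> (f [^]\<^bsub>A\<^esub> (n + n)) = \<iota> y"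
          using eigenvector_clear_denominator(2)[OF extends two \<open>a \<in> antifixed_part Q \<theta>'\<close>] by blast
        then show ?thesis
          using that contraction_antifixed[OF inv] contraction_antifixed[OF extends(1)]
          by (intro clear[of a "- 1" y n]) (auto simp: antifixed_part_def)
      qed
    qed
    with y show "\<exists>p\<in>carrier ?B. \<exists>s\<in>powers ?B ?F. y \<otimes>\<^bsub>?C\<^esub> \<psi> s = \<psi> p" by blast
  next
    show "\<psi> (c \<odot>\<^bsub>?B\<^esub> p) = c \<odot>\<^bsub>?C\<^esub> \<psi> p" if "c \<in> carrier (UP K)" "p \<in> carrier ?B" for c p
      using that by (simp add: ops \<psi>_smult BL)
  qed (rule that)
  then have "algebra_isomorphic (UP K) (localization_at ?B ?F) ?C"
    by (auto simp: algebra_isomorphic_def localization_at_def)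
  then show ?thesis
    unfolding localization_at_def
    \<comment> \<open>The criterion yields a map out of the localization; the claim has the opposite
      direction.\<close>
    by (rule algebra_isomorphic_sym[OF S.cring_localization
          S.scalars_multiplicative_localization[OF scalars_multiplicative_contraction[OF inv]]])
qed

end

text \<open>The isomorphisms are asserted for every extension \<open>\<theta>'\<close> of the
  involution, not just for the one constructed. The monomials of exponent 0 and 1 encode
  \<open>f\<close> and its product with the square root of t. If both sign conditions hold, both
  isomorphisms are claimed.\<close>

theorem proposition1p6:
  fixes K :: "('k, 'r) ring_scheme" and A :: "('k, 'a, 'm) module_scheme"
    and \<theta> :: "'a \<Rightarrow> 'a" and f :: 'a
  assumes "involutive_algebra K A \<theta>"
    and "\<one>\<^bsub>K\<^esub> \<oplus>\<^bsub>K\<^esub> \<one>\<^bsub>K\<^esub> \<in> Units K"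
    and "f \<in> carrier A"
    and "\<theta> f = f \<or> \<theta> f = \<ominus>\<^bsub>A\<^esub> f"
  shows "(\<exists>\<theta>'. involutive_algebra K (localization_at A f) \<theta>' \<and>
            (\<forall>a\<in>carrier A. \<theta>' (to_localization_at A f a) = to_localization_at A f (\<theta> a))) \<and>
    (\<forall>\<theta>'. involutive_algebra K (localization_at A f) \<theta>' \<and>
            (\<forall>a\<in>carrier A. \<theta>' (to_localization_at A f a) = to_localization_at A f (\<theta> a)) \<longrightarrow>
       (\<theta> f = f \<longrightarrow>
          algebra_isomorphic (UP K)
            (contraction_algebra K (localization_at A f) \<theta>')
            (localization_at (contraction_algebra K A \<theta>) (laurent_monom A f 0))) \<and>
       (\<theta> f = \<ominus>\<^bsub>A\<^esub> f \<longrightarrow>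
          algebra_isomorphic (UP K)
            (contraction_algebra K (localization_at A f) \<theta>')
            (localization_at (contraction_algebra K A \<theta>) (laurent_monom A f 1))))"
proof -
  interpret involutive_algebra K A \<theta> by fact
  interpret localized_involution K A f \<theta>
    by (intro localized_involution.intro localized_algebra.intro localized_involution_axioms.intro)
      (fact algebra_axioms assms)+
  show ?thesis
  proof (intro conjI allI impI)
    show "\<exists>\<theta>'. involutive_algebra K Q \<theta>' \<and> (\<forall>a\<in>carrier A. \<theta>' (\<iota> a) = \<iota> (\<theta> a))"
      by (rule involution_extends)
  next
    fix \<theta>' assume "involutive_algebra K Q \<theta>' \<and> (\<forall>a\<in>carrier A. \<theta>' (\<iota> a) = \<iota> (\<theta> a))"
    then have "involutive_algebra K Q \<theta>'" "\<And>a. a \<in> carrier A \<Longrightarrow> \<theta>' (\<iota> a) = \<iota> (\<theta> a)"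
      by blast+
    note iso = contraction_localization[OF this assms(2)]
    show "algebra_isomorphic (UP K) (contraction_algebra K Q \<theta>')
        (localization_at (contraction_algebra K A \<theta>) (laurent_monom A f 0))" if "\<theta> f = f"
      using iso[of 0] that by simp
    show "algebra_isomorphic (UP K) (contraction_algebra K Q \<theta>')
        (localization_at (contraction_algebra K A \<theta>) (laurent_monom A f 1))" if "\<theta> f = \<ominus>\<^bsub>A\<^esub> f"
      using iso[of 1] that by simp
  qed
qed

end
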